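(* Let $\Delta$ be the maximum degree of the random graph $G_{n,p}$. If $p=p(n) \geq \frac{\log^4 n}{n}$, then almost surely every collection of disjoint vertex subsets $V_1,\ldots,V_r$ of $G_{n,p}$ with all $|V_i|\geq (1+o(1))\Delta$ has an independent transversal. That is, for every fixed $\epsilon>0$, the following holds almost surely: every collection of disjoint vertex subsets $V_1,\ldots,V_r$ of $G_{n,p}$ with $|V_i|\ge(1+\epsilon)\Delta$ for all $i$ has an independent transversal.
   Context: $G_{n,p}$ is the probability space of all labeled graphs on $n$ vertices in which every edge appears randomly and independently with probability $p=p(n)$. A property holds almost surely if the probability that it holds tends to $1$ as $n\to\infty$. All logarithms are natural. An independent transversal with respect to disjoint vertex subsets $V_1,\dots,V_r$ of a graph is an independent set of the graph which contains exactly one vertex from each $V_i$. *)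

theory Defs
  imports "HOL-Probability.Probability"
begin

(* A labeled simple graph on the vertex set {..<n} is represented by its set of
   edges, a subset of all_edges n. *)
definition all_edges :: "nat \<Rightarrow> nat set set" where
  "all_edges n = {e. e \<subseteq> {..<n} \<and> card e = 2}"

definition gnp :: "nat \<Rightarrow> real \<Rightarrow> nat set set pmf" where
  "gnp n p = map_pmf (\<lambda>f. {e \<in> all_edges n. f e})
     (Pi_pmf (all_edges n) False (\<lambda>_. bernoulli_pmf p))"

definition degree :: "nat set set \<Rightarrow> nat \<Rightarrow> nat" where
  "degree E v = card {e \<in> E. v \<in> e}"

(* Only meaningful for n > 0: Max {} is unspecified. *)
definition max_degree :: "nat \<Rightarrow> nat set set \<Rightarrow> nat" where
  "max_degree n E = Max (degree E ` {..<n})"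

definition independent_set :: "nat \<Rightarrow> nat set set \<Rightarrow> nat set \<Rightarrow> bool" where
  "independent_set n E T \<longleftrightarrow> T \<subseteq> {..<n} \<and> (\<forall>u\<in>T. \<forall>v\<in>T. {u, v} \<notin> E)"

definition independent_transversal ::
  "nat \<Rightarrow> nat set set \<Rightarrow> nat \<Rightarrow> (nat \<Rightarrow> nat set) \<Rightarrow> nat set \<Rightarrow> bool" where
  "independent_transversal n E r V T \<longleftrightarrow>
     independent_set n E T \<and> (\<forall>i<r. card (T \<inter> V i) = 1)"

definition almost_surely :: "(nat \<Rightarrow> real) \<Rightarrow> (nat \<Rightarrow> nat set set \<Rightarrow> bool) \<Rightarrow> bool" where
  "almost_surely p P \<longleftrightarrow>
     (\<lambda>n. measure_pmf.prob (gnp n (p n)) {E. P n E}) \<longlonglongrightarrow> 1"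

end

theory Submission
  imports Defs "HOL-Library.Z2" "HOL-Real_Asymp.Real_Asymp"
begin

text \<open>
  By the homological version of Hall's theorem, it suffices that for every set of \<open>s\<close> classes with
  union \<open>W\<close> the independence complex of the graph induced on \<open>W\<close> is connected up to dimension
  \<open>s - 2\<close>. This is shown with Meshulam's exact sequence: an edge may either be deleted, or exploded,
  i.e. removed together with all neighbours of its end points, which costs one dimension.

  Only edges whose two ends have no more neighbours in the current vertex set \<open>U\<close> than expected,
  about \<open>p |U|\<close>, are offered; all but few vertices of \<open>U\<close> qualify. If \<open>t < s\<close> such edges have been
  exploded and all others deleted, then the qualifying vertices are independent, and the complex is
  connected enough unless \<open>s - t - 1\<close> vertices dominate them. If \<open>|W| \<le> n / 8\<close>, each explosion removes at
  most \<open>\<Delta>\<close> vertices, so that domination would require \<open>(s - 1) \<Delta>\<close> to be almost \<open>|W|\<close>. Otherwise about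
  \<open>|W| (1 - p) ^ (2 t)\<close> vertices survive. The set \<open>D\<close> of the \<open>2 t\<close> exploded vertices leaves about
  \<open>n (1 - p) ^ (2 t)\<close> vertices of the whole graph undominated, and of these \<open>b = s - t - 1\<close> further vertices
  dominate a fraction of at most \<open>b p\<close>; this is not enough because \<open>|W|\<close> exceeds \<open>s n p\<close> by a factor
  bounded away from \<open>1\<close>.
\<close>

section \<open>Homology modulo 2\<close>

declare add_bit_eq_xor [simp del] mult_bit_eq_and [simp del] bit_not_zero_iff [simp del] bit_not_one_iff [simp del]

lemma bit_add_self: "(x::bit) + x = 0"
  by (cases x) (simp_all add: add_bit_eq_xor)

lemma bit_add_eq_0_iff: "(x::bit) + y = 0 \<longleftrightarrow> x = y"
  by (cases x; cases y) (simp_all add: add_bit_eq_xor)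

text \<open>The boundary modulo 2, read coefficientwise: a face collects the coefficients of all
  sets one vertex larger, so neither signs nor an order of the vertices occur. Chains are functions
  on all sets, which is why the ground set \<open>X\<close> is a parameter.\<close>

definition bd :: "'a set \<Rightarrow> ('a set \<Rightarrow> bit) \<Rightarrow> 'a set \<Rightarrow> bit" where
  "bd X c \<tau> = (\<Sum>v\<in>X - \<tau>. c (insert v \<tau>))"

definition chain :: "'a set set \<Rightarrow> nat \<Rightarrow> ('a set \<Rightarrow> bit) \<Rightarrow> bool" where
  "chain K d c \<longleftrightarrow> (\<forall>\<sigma>. c \<sigma> \<noteq> 0 \<longrightarrow> \<sigma> \<in> K \<and> card \<sigma> = d)"

text \<open>Simplices are graded by cardinality, the empty simplex included: \<open>connected_upto X K k\<close> says that
  the reduced homology of \<open>K\<close> modulo 2 vanishes in all dimensions below \<open>k - 1\<close>.\<close>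

definition connected_upto :: "'a set \<Rightarrow> 'a set set \<Rightarrow> nat \<Rightarrow> bool" where
  "connected_upto X K k \<longleftrightarrow>
     (\<forall>d<k. \<forall>c. chain K d c \<and> bd X c = (\<lambda>_. 0) \<longrightarrow> (\<exists>b. chain K (Suc d) b \<and> bd X b = c))"

lemma connected_uptoD:
  "connected_upto X K k \<Longrightarrow> d < k \<Longrightarrow> chain K d c \<Longrightarrow> bd X c = (\<lambda>_. 0) \<Longrightarrow>
    \<exists>b. chain K (Suc d) b \<and> bd X b = c"
  unfolding connected_upto_def by blast

text \<open>The join of the vertex \<open>u\<close> with the chain \<open>a\<close>; values of
  \<open>a\<close> on sets containing \<open>u\<close> do not enter.\<close>

definition vertex_join :: "'a \<Rightarrow> ('a set \<Rightarrow> bit) \<Rightarrow> 'a set \<Rightarrow> bit" where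
  "vertex_join u a \<sigma> = (if u \<in> \<sigma> then a (\<sigma> - {u}) else 0)"

text \<open>Modulo 2 the ordered pairs \<open>(v, w)\<close> and \<open>(w, v)\<close> cancel. This
  is why a double boundary vanishes, for simplices of vertices and for faces of colours
  alike.\<close>

lemma sum_symmetric_pairs_bit:
  fixes f :: "'a \<Rightarrow> 'a \<Rightarrow> bit"
  assumes "finite Y" "\<And>v w. v \<in> Y \<Longrightarrow> w \<in> Y \<Longrightarrow> f v w = f w v"
  shows "(\<Sum>v\<in>Y. \<Sum>w\<in>Y - {v}. f v w) = 0"
  using assms
proof (induction Y rule: finite_induct)
  case (insert x F)
  have "(\<Sum>v\<in>insert x F. \<Sum>w\<in>insert x F - {v}. f v w)
      = (\<Sum>w\<in>F. f x w) + (\<Sum>v\<in>F. \<Sum>w\<in>insert x F - {v}. f v w)"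
    using insert by (simp add: insert_Diff_if)
  also have "(\<Sum>v\<in>F. \<Sum>w\<in>insert x F - {v}. f v w) = (\<Sum>v\<in>F. f v x + (\<Sum>w\<in>F - {v}. f v w))"
  proof (rule sum.cong)
    fix v assume v: "v \<in> F"
    then have "insert x F - {v} = insert x (F - {v})" using insert by auto
    then show "(\<Sum>w\<in>insert x F - {v}. f v w) = f v x + (\<Sum>w\<in>F - {v}. f v w)"
      using insert by simp
  qed simp
  also have "\<dots> = (\<Sum>v\<in>F. f v x) + (\<Sum>v\<in>F. \<Sum>w\<in>F - {v}. f v w)"
    by (simp add: sum.distrib)
  also have "(\<Sum>v\<in>F. \<Sum>w\<in>F - {v}. f v w) = 0"
    using insert by simp
  also have "(\<Sum>v\<in>F. f v x) = (\<Sum>v\<in>F. f x v)"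
    using insert.prems by (intro sum.cong) auto
  finally show ?case by (simp add: bit_add_self)
qed simp

lemma bd_bd:
  assumes "finite X"
  shows "bd X (bd X c) = (\<lambda>_. 0)"
proof
  fix \<tau>
  have "bd X (bd X c) \<tau> = (\<Sum>v\<in>X - \<tau>. \<Sum>w\<in>(X - \<tau>) - {v}. c (insert w (insert v \<tau>)))"
    unfolding bd_def by (intro sum.cong refl) auto
  also have "\<dots> = 0"
    using assms by (intro sum_symmetric_pairs_bit) (auto simp: insert_commute)
  finally show "bd X (bd X c) \<tau> = 0" .
qed

lemma bd_add: "bd X (\<lambda>\<sigma>. a \<sigma> + b \<sigma>) = (\<lambda>\<tau>. bd X a \<tau> + bd X b \<tau>)"
  by (rule ext) (simp add: bd_def sum.distrib)

text \<open>The Leibniz rule: dropping \<open>u\<close> from the join gives back \<open>a\<close>,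
  dropping another vertex happens inside \<open>a\<close>. As \<open>a\<close> vanishes on sets
  containing \<open>u\<close>, the summand of \<open>bd X a (\<tau> - {u})\<close> that puts
  \<open>u\<close> back is zero.\<close>

lemma bd_vertex_join:
  assumes "finite X" "u \<in> X" "\<And>\<tau>. u \<in> \<tau> \<Longrightarrow> a \<tau> = 0"
  shows "bd X (vertex_join u a) = (\<lambda>\<tau>. a \<tau> + vertex_join u (bd X a) \<tau>)"
proof
  fix \<tau>
  show "bd X (vertex_join u a) \<tau> = a \<tau> + vertex_join u (bd X a) \<tau>"
  proof (cases "u \<in> \<tau>")
    case False
    have "bd X (vertex_join u a) \<tau> = (\<Sum>v\<in>X - \<tau>. if v = u then a \<tau> else 0)"
      unfolding bd_def vertex_join_def using False by (intro sum.cong) auto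
    also have "\<dots> = a \<tau>" using assms False by simp
    finally show ?thesis using False by (simp add: vertex_join_def)
  next
    case True
    have "bd X a (\<tau> - {u}) = (\<Sum>v\<in>insert u (X - \<tau>). a (insert v (\<tau> - {u})))"
      unfolding bd_def using True assms by (intro sum.cong) auto
    also have "\<dots> = a \<tau> + (\<Sum>v\<in>X - \<tau>. a (insert v (\<tau> - {u})))"
      using True assms by (simp add: insert_absorb)
    also have "(\<Sum>v\<in>X - \<tau>. a (insert v (\<tau> - {u}))) = bd X (vertex_join u a) \<tau>"
      unfolding bd_def vertex_join_def using True
      by (intro sum.cong refl) (auto simp: insert_Diff_if)
    finally show ?thesis using True assms by (simp add: vertex_join_def)
  qed
qed

lemma chain_bd:
  assumes "chain K (Suc d) c" "\<And>\<sigma> \<tau>. \<sigma> \<in> K \<Longrightarrow> \<tau> \<subseteq> \<sigma> \<Longrightarrow> \<tau> \<in> K" "\<And>\<sigma>. \<sigma> \<in> K \<Longrightarrow> finite \<sigma>"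
  shows "chain K d (bd X c)"
  unfolding chain_def
proof (intro allI impI)
  fix \<tau> assume "bd X c \<tau> \<noteq> 0"
  then obtain v where v: "v \<in> X - \<tau>" "c (insert v \<tau>) \<noteq> 0"
    unfolding bd_def by (meson sum.neutral)
  then have *: "insert v \<tau> \<in> K" "card (insert v \<tau>) = Suc d"
    using assms(1) by (auto simp: chain_def)
  then have "finite \<tau>" using assms(3) by fastforce
  then show "\<tau> \<in> K \<and> card \<tau> = d"
    using * v assms(2)[of "insert v \<tau>" \<tau>] by auto
qed

text \<open>A cone with apex \<open>u\<close> is acyclic: a cycle \<open>c\<close> bounds the join
  of \<open>u\<close> with the part of \<open>c\<close> avoiding \<open>u\<close>. The cycle
  condition at \<open>\<tau> - {u}\<close> makes the boundary of this join also restore the part of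
  \<open>c\<close> through \<open>u\<close>.\<close>

lemma connected_upto_cone:
  assumes "finite X" "u \<in> X" "\<And>\<sigma>. \<sigma> \<in> K \<Longrightarrow> insert u \<sigma> \<in> K" "\<And>\<sigma>. \<sigma> \<in> K \<Longrightarrow> \<sigma> \<subseteq> X"
  shows "connected_upto X K k"
  unfolding connected_upto_def
proof (intro allI impI)
  fix d c assume c: "chain K d c \<and> bd X c = (\<lambda>_. 0)"
  define a where "a \<sigma> = (if u \<in> \<sigma> then 0 else c \<sigma>)" for \<sigma>
  define a' where "a' \<sigma> = (if u \<in> \<sigma> then c \<sigma> else 0)" for \<sigma>
  have fin: "finite \<sigma>" if "\<sigma> \<in> K" for \<sigma>
    using that assms(1,4) finite_subset by blast
  have "chain K (Suc d) (vertex_join u a)"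
    unfolding chain_def
  proof (intro allI impI)
    fix \<sigma> assume "vertex_join u a \<sigma> \<noteq> 0"
    then have u: "u \<in> \<sigma>" "c (\<sigma> - {u}) \<noteq> 0" by (auto simp: vertex_join_def a_def split: if_splits)
    then have "\<sigma> - {u} \<in> K" "card (\<sigma> - {u}) = d" using c by (auto simp: chain_def)
    then show "\<sigma> \<in> K \<and> card \<sigma> = Suc d"
      using u assms(3)[of "\<sigma> - {u}"] fin[of "\<sigma> - {u}"]
      by (metis card_Suc_Diff1 finite_Diff2 finite.simps insert_Diff)
  qed
  moreover have "bd X (vertex_join u a) = c"
  proof
    fix \<tau>
    have "bd X (vertex_join u a) \<tau> = a \<tau> + vertex_join u (bd X a) \<tau>"
      using assms(1,2) by (subst bd_vertex_join) (auto simp: a_def)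
    also have "vertex_join u (bd X a) \<tau> = a' \<tau>"
    proof (cases "u \<in> \<tau>")
      case True
      have eq: "X - (\<tau> - {u}) = insert u (X - \<tau>)" using True assms(2) by auto
      have "bd X a (\<tau> - {u}) = (\<Sum>v\<in>X - \<tau>. c (insert v (\<tau> - {u})))"
        unfolding bd_def eq using assms(1) True
        by (auto simp: a_def intro!: sum.cong)
      moreover have "bd X c (\<tau> - {u}) = c \<tau> + (\<Sum>v\<in>X - \<tau>. c (insert v (\<tau> - {u})))"
        unfolding bd_def eq using assms(1) True by (simp add: insert_absorb)
      moreover have "bd X c (\<tau> - {u}) = 0" using c by simp
      ultimately have "bd X a (\<tau> - {u}) = c \<tau>" using bit_add_eq_0_iff by metis
      then show ?thesis using True by (simp add: vertex_join_def a'_def)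
    qed (simp add: vertex_join_def a'_def)
    also have "a \<tau> + a' \<tau> = c \<tau>" by (simp add: a_def a'_def)
    finally show "bd X (vertex_join u a) \<tau> = c \<tau>" .
  qed
  ultimately show "\<exists>b. chain K (Suc d) b \<and> bd X b = c" by blast
qed

text \<open>Adding the edge \<open>uv\<close> to a graph deletes from its independence complex \<open>K'\<close> the simplices
  \<open>{u, v} \<union> \<tau>\<close> with \<open>\<tau> \<in> L\<close>; a filling \<open>b\<close> of a cycle in \<open>K'\<close> is pushed off them by
  subtracting the boundary of the join of \<open>{u, v}\<close> with a filling of the link of \<open>{u, v}\<close> in \<open>b\<close>.\<close>

lemma connected_upto_explode:
  fixes K K' L :: "'a set set"
  assumes "finite X" "u \<in> X" "v \<in> X" "u \<noteq> v"
    and K: "K = {\<sigma> \<in> K'. \<not> {u, v} \<subseteq> \<sigma>}"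
    and sub: "\<And>\<sigma>. \<sigma> \<in> K' \<Longrightarrow> \<sigma> \<subseteq> X"
    and down: "\<And>\<sigma> \<tau>. \<sigma> \<in> K' \<Longrightarrow> \<tau> \<subseteq> \<sigma> \<Longrightarrow> \<tau> \<in> K'"
    and L: "\<And>\<tau>. u \<notin> \<tau> \<Longrightarrow> v \<notin> \<tau> \<Longrightarrow> insert u (insert v \<tau>) \<in> K' \<Longrightarrow> \<tau> \<in> L"
    and L': "\<And>\<tau>. \<tau> \<in> L \<Longrightarrow> u \<notin> \<tau> \<and> v \<notin> \<tau> \<and> insert u (insert v \<tau>) \<in> K'"
    and conn: "connected_upto X K' (Suc k)" "connected_upto X L k"
  shows "connected_upto X K (Suc k)"
  unfolding connected_upto_def
proof (intro allI impI)
  fix d c assume d: "d < Suc k" and c: "chain K d c \<and> bd X c = (\<lambda>_. 0)"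
  have fin: "finite \<sigma>" if "\<sigma> \<in> K'" for \<sigma>
    using that assms(1) sub finite_subset by blast
  have "chain K' d c" using c K by (auto simp: chain_def)
  then obtain b where b: "chain K' (Suc d) b" "bd X b = c"
    using conn(1) c d unfolding connected_upto_def by blast
  \<comment> \<open>The link of \<open>{u, v}\<close> in the filling \<open>b\<close>.\<close>
  define a where "a \<tau> = (if u \<in> \<tau> \<or> v \<in> \<tau> then 0 else b (insert u (insert v \<tau>)))" for \<tau>
  have a_card: "\<tau> \<in> L \<and> Suc (card \<tau>) = d" if "a \<tau> \<noteq> 0" for \<tau>
  proof -
    have uv: "u \<notin> \<tau>" "v \<notin> \<tau>" "b (insert u (insert v \<tau>)) \<noteq> 0"
      using that by (auto simp: a_def split: if_splits)
    then have *: "insert u (insert v \<tau>) \<in> K'" "card (insert u (insert v \<tau>)) = Suc d"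
      using b by (auto simp: chain_def)
    then have "finite \<tau>" using fin by fastforce
    then show ?thesis using * uv L \<open>u \<noteq> v\<close> by auto
  qed
  have bda: "bd X a = (\<lambda>_. 0)"
  proof
    fix \<tau>
    show "bd X a \<tau> = 0"
    proof (cases "u \<in> \<tau> \<or> v \<in> \<tau>")
      case True
      then show ?thesis unfolding bd_def a_def by (intro sum.neutral) auto
    next
      case False
      \<comment> \<open>The cycle \<open>c\<close> lives on \<open>K\<close>, so it has no simplex
        containing both \<open>u\<close> and \<open>v\<close>; on such sets the boundary of
        \<open>b\<close> is the boundary of its link.\<close>
      have "c (insert u (insert v \<tau>)) = 0" using c K by (auto simp: chain_def)
      then have "0 = bd X b (insert u (insert v \<tau>))" using b by simp
      also have "\<dots> = (\<Sum>w\<in>X - insert u (insert v \<tau>). a (insert w \<tau>))"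
        unfolding bd_def using False by (intro sum.cong refl) (auto simp: a_def insert_commute)
      also have "\<dots> = bd X a \<tau>"
        unfolding bd_def using assms(1) by (intro sum.mono_neutral_left) (auto simp: a_def)
      finally show ?thesis by simp
    qed
  qed
  \<comment> \<open>Simplices of \<open>a\<close> have one vertex less than those of
    \<open>c\<close>, so \<open>d < Suc k\<close> is what connectivity of \<open>L\<close> up to
    \<open>k\<close> can handle; for \<open>d = 0\<close> there are none and \<open>a\<close> is
    zero.\<close>
  obtain a' where a': "chain L d a'" "bd X a' = a"
  proof (cases d)
    case 0
    have "a = (\<lambda>_. 0)" using a_card 0 by fastforce
    then have "bd X (\<lambda>_. 0) = a" by (auto simp: bd_def)
    then show ?thesis using that[of "\<lambda>_. 0"] by (simp add: chain_def)
  next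
    case (Suc d')
    then have "chain L d' a" using a_card by (auto simp: chain_def)
    then show ?thesis using conn(2) bda d Suc that unfolding connected_upto_def by blast
  qed
  define e where "e = vertex_join u (vertex_join v a')"
  have a'0: "a' \<tau> = 0" if "u \<in> \<tau> \<or> v \<in> \<tau>" for \<tau>
    using that a'(1) L' unfolding chain_def by blast
  have bde: "bd X e = (\<lambda>\<tau>. vertex_join v a' \<tau> + vertex_join u (\<lambda>\<tau>. a' \<tau> + vertex_join v a \<tau>) \<tau>)"
  proof -
    have "bd X (vertex_join v a') = (\<lambda>\<tau>. a' \<tau> + vertex_join v a \<tau>)"
      using assms a'0 a' by (subst bd_vertex_join) auto
    then show ?thesis unfolding e_def using assms a'0
      by (subst bd_vertex_join) (auto simp: vertex_join_def)
  qed
  have e: "chain K' (Suc (Suc d)) e"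
    unfolding chain_def
  proof (intro allI impI)
    fix \<sigma> assume "e \<sigma> \<noteq> 0"
    then have uv: "u \<in> \<sigma>" "v \<in> \<sigma>" "a' (\<sigma> - {u} - {v}) \<noteq> 0"
      by (auto simp: e_def vertex_join_def split: if_splits)
    define \<rho> where "\<rho> = \<sigma> - {u} - {v}"
    have r: "\<rho> \<in> L" "card \<rho> = d" using uv a' by (auto simp: chain_def \<rho>_def)
    have s: "\<sigma> = insert u (insert v \<rho>)" using uv by (auto simp: \<rho>_def)
    have K: "\<sigma> \<in> K'" using s r L' by simp
    then have "finite \<rho>" using fin s by fastforce
    with K show "\<sigma> \<in> K' \<and> card \<sigma> = Suc (Suc d)"
      using s r L'[OF r(1)] \<open>u \<noteq> v\<close> by simp
  qed
  define b' where "b' \<sigma> = b \<sigma> + bd X e \<sigma>" for \<sigma>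
  have "chain K' (Suc d) (bd X e)" using e down fin by (rule chain_bd)
  then have "\<sigma> \<in> K' \<and> card \<sigma> = Suc d" if "b' \<sigma> \<noteq> 0" for \<sigma>
    using that b(1) unfolding chain_def b'_def by (metis add_0_right)
  \<comment> \<open>On sets containing \<open>u\<close> and \<open>v\<close> the boundary of
    \<open>e\<close> reduces to the link \<open>a\<close>, hence agrees with \<open>b\<close>, and
    the two cancel modulo 2.\<close>
  moreover have "b' \<sigma> = 0" if "{u, v} \<subseteq> \<sigma>" for \<sigma>
  proof -
    have *: "insert u (insert v (\<sigma> - {u} - {v})) = \<sigma>" using that by auto
    have "bd X e \<sigma> = a (\<sigma> - {u} - {v})"
      using that \<open>u \<noteq> v\<close> a'0 by (simp add: bde vertex_join_def)
    also have "\<dots> = b (insert u (insert v (\<sigma> - {u} - {v})))" by (simp add: a_def)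
    also have "\<dots> = b \<sigma>" unfolding * ..
    finally show ?thesis by (simp add: b'_def bit_add_self)
  qed
  ultimately have "chain K (Suc d) b'" unfolding chain_def K by blast
  moreover have "bd X b' = c"
    unfolding b'_def bd_add by (simp add: b bd_bd[OF assms(1)])
  ultimately show "\<exists>b. chain K (Suc d) b \<and> bd X b = c" by blast
qed

section \<open>Hall's theorem for simplicial complexes\<close>

text \<open>A chain map from the full simplex on the colours \<open>I\<close> to \<open>K\<close> carrying the face \<open>S\<close> to a chain
  that only uses vertices with colours in \<open>S\<close>.\<close>

lemma carried_chain_map:
  fixes V :: "'i \<Rightarrow> 'a set"
  assumes "finite X" "finite I" "{} \<in> K"
    and conn: "\<And>S. S \<subseteq> I \<Longrightarrow> connected_upto X {\<sigma> \<in> K. \<sigma> \<subseteq> \<Union>(V ` S)} (card S)"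
  obtains f where "f {} = (\<lambda>\<sigma>. if \<sigma> = {} then 1 else 0)"
    "\<And>S. S \<subseteq> I \<Longrightarrow> chain {\<sigma> \<in> K. \<sigma> \<subseteq> \<Union>(V ` S)} (card S) (f S)"
    "\<And>S. S \<subseteq> I \<Longrightarrow> bd X (f S) = (\<lambda>\<tau>. \<Sum>i\<in>S. f (S - {i}) \<tau>)"
proof -
  define good where "good f S \<longleftrightarrow> chain {\<sigma> \<in> K. \<sigma> \<subseteq> \<Union>(V ` S)} (card S) (f S) \<and>
      bd X (f S) = (\<lambda>\<tau>. \<Sum>i\<in>S. f (S - {i}) \<tau>)" for f :: "'i set \<Rightarrow> 'a set \<Rightarrow> bit" and S
  have "\<exists>f. f {} = (\<lambda>\<sigma>. if \<sigma> = {} then 1 else 0) \<and> (\<forall>S\<subseteq>I. card S \<le> k \<longrightarrow> good f S)" for k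
  proof (induction k)
    case 0
    \<comment> \<open>Only \<open>S = {}\<close> has cardinality 0; the values at other
      \<open>S\<close> are mere defaults.\<close>
    let ?f = "\<lambda>S \<sigma>. if \<sigma> = {} then 1 else 0 :: bit"
    have "good ?f {}"
      using assms by (auto simp: good_def chain_def bd_def intro!: ext sum.neutral)
    moreover have "S = {}" if "S \<subseteq> I" "card S \<le> 0" for S
      using that assms(2) finite_subset by fastforce
    ultimately show ?case by (intro exI[of _ ?f]) blast
  next
    case (Suc k)
    then obtain f where f0: "f {} = (\<lambda>\<sigma>. if \<sigma> = {} then 1 else 0)"
      and f: "\<And>S. S \<subseteq> I \<Longrightarrow> card S \<le> k \<Longrightarrow> good f S" by blast
    have "\<exists>b. chain {\<sigma> \<in> K. \<sigma> \<subseteq> \<Union>(V ` S)} (Suc k) b \<and> bd X b = (\<lambda>\<tau>. \<Sum>i\<in>S. f (S - {i}) \<tau>)"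
      if S: "S \<subseteq> I" "card S = Suc k" for S
    proof -
      let ?c = "\<lambda>\<tau>. \<Sum>i\<in>S. f (S - {i}) \<tau>"
      have finS: "finite S" using S assms(2) finite_subset by blast
      have card: "card (S - {i}) = k" if "i \<in> S" for i using S that finS by simp
      have gd: "good f (S - {i})" if "i \<in> S" for i
        using f[of "S - {i}"] S card[OF that] by auto
      have "chain {\<sigma> \<in> K. \<sigma> \<subseteq> \<Union>(V ` S)} k ?c"
        unfolding chain_def
      proof (intro allI impI)
        fix \<sigma> assume "?c \<sigma> \<noteq> 0"
        then obtain i where i: "i \<in> S" "f (S - {i}) \<sigma> \<noteq> 0" by (meson sum.neutral)
        then show "\<sigma> \<in> {\<sigma> \<in> K. \<sigma> \<subseteq> \<Union>(V ` S)} \<and> card \<sigma> = k"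
          using gd[OF i(1)] card[OF i(1)] unfolding good_def chain_def by auto
      qed
      moreover have "bd X ?c = (\<lambda>_. 0)"
      proof
        fix \<tau>
        have "bd X ?c \<tau> = (\<Sum>i\<in>S. bd X (f (S - {i})) \<tau>)"
          unfolding bd_def by (rule sum.swap)
        also have "\<dots> = (\<Sum>i\<in>S. \<Sum>j\<in>S - {i}. f (S - {i} - {j}) \<tau>)"
          using gd by (intro sum.cong) (auto simp: good_def)
        also have "\<dots> = 0"
        proof (rule sum_symmetric_pairs_bit[OF finS])
          fix i j
          have "S - {i} - {j} = S - {j} - {i}" by blast
          then show "f (S - {i} - {j}) \<tau> = f (S - {j} - {i}) \<tau>" by simp
        qed
        finally show "bd X ?c \<tau> = 0" .
      qed
      \<comment> \<open>The prescribed boundary has cardinality \<open>k < card S\<close>, so the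
        connectivity assumed for \<open>S\<close> fills it.\<close>
      ultimately show ?thesis
        using conn[OF S(1)] S(2) by (intro connected_uptoD) auto
    qed
    note filling = this
    define g where "g S = (SOME b. chain {\<sigma> \<in> K. \<sigma> \<subseteq> \<Union>(V ` S)} (Suc k) b \<and>
        bd X b = (\<lambda>\<tau>. \<Sum>i\<in>S. f (S - {i}) \<tau>))" for S
    have g: "chain {\<sigma> \<in> K. \<sigma> \<subseteq> \<Union>(V ` S)} (Suc k) (g S) \<and>
        bd X (g S) = (\<lambda>\<tau>. \<Sum>i\<in>S. f (S - {i}) \<tau>)" if "S \<subseteq> I" "card S = Suc k" for S
      unfolding g_def by (rule someI_ex[OF filling[OF that]])
    define f' where "f' S = (if card S = Suc k then g S else f S)" for S
    have "good f' S" if S: "S \<subseteq> I" "card S \<le> Suc k" for S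
    proof -
      have "finite S" using S assms(2) finite_subset by blast
      then have *: "f' (S - {i}) = f (S - {i})" if "i \<in> S" for i
        using that S by (auto simp: f'_def card_Diff_singleton)
      show ?thesis
      proof (cases "card S = Suc k")
        case True
        then show ?thesis using g[OF S(1) True] * by (simp add: good_def f'_def[of S])
      next
        case False
        then show ?thesis using f[OF S(1)] S * by (simp add: good_def f'_def[of S])
      qed
    qed
    moreover have "f' {} = f {}" by (simp add: f'_def)
    ultimately show ?case using f0 by (intro exI[of _ f']) simp
  qed
  then obtain f where "f {} = (\<lambda>\<sigma>. if \<sigma> = {} then 1 else 0)"
    "\<And>S. S \<subseteq> I \<Longrightarrow> card S \<le> card I \<Longrightarrow> good f S" by blast
  then show ?thesis
    using that[of f] card_mono[OF assms(2)] unfolding good_def by blast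
qed

definition colourful :: "('i \<Rightarrow> 'a set) \<Rightarrow> 'i set \<Rightarrow> 'a set \<Rightarrow> bool" where
  "colourful V S \<sigma> \<longleftrightarrow> \<sigma> \<subseteq> \<Union>(V ` S) \<and> (\<forall>i\<in>S. card (\<sigma> \<inter> V i) = 1)"

lemma colourful_facets_parity:
  fixes V :: "'i \<Rightarrow> 'a set"
  assumes "finite \<sigma>" "i \<notin> S" "disjoint_family_on V (insert i S)"
    and sub: "\<sigma> \<subseteq> \<Union>(V ` insert i S)"
  shows "of_nat (card {v \<in> \<sigma>. colourful V S (\<sigma> - {v})}) = (if colourful V (insert i S) \<sigma> then 1 else 0 :: bit)"
proof -
  have disj: "j = k" if "x \<in> V j" "x \<in> V k" "j \<in> insert i S" "k \<in> insert i S" for x j k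
    using that assms(3) unfolding disjoint_family_on_def by blast
  have keep: "(\<sigma> - {v}) \<inter> V k = \<sigma> \<inter> V k" if "v \<in> V j" "j \<noteq> k" "j \<in> insert i S" "k \<in> insert i S" for v j k
    using disj that by blast
  show ?thesis
  proof (cases "colourful V (insert i S) \<sigma>")
    case True
    then obtain x where x: "\<sigma> \<inter> V i = {x}"
      by (auto simp: colourful_def card_1_singleton_iff)
    then have xi: "x \<in> V i" "x \<in> \<sigma>" by auto
    have "{v \<in> \<sigma>. colourful V S (\<sigma> - {v})} = {x}"
    proof (intro equalityI subsetI)
      fix v assume v: "v \<in> {v \<in> \<sigma>. colourful V S (\<sigma> - {v})}"
      have "x \<notin> \<Union>(V ` S)" using x disj assms(2) by blast
      then have "x \<notin> \<sigma> - {v}" using v by (auto simp: colourful_def)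
      then show "v \<in> {x}" using x by blast
    next
      fix v assume "v \<in> {x}"
      then have v: "v = x" by simp
      have "\<sigma> - {x} \<subseteq> \<Union>(V ` S)" using sub x by blast
      moreover have "card ((\<sigma> - {x}) \<inter> V k) = 1" if "k \<in> S" for k
      proof -
        have "(\<sigma> - {x}) \<inter> V k = \<sigma> \<inter> V k" using keep[of x i k] xi that assms(2) by auto
        then show ?thesis using that True by (simp add: colourful_def)
      qed
      ultimately show "v \<in> {v \<in> \<sigma>. colourful V S (\<sigma> - {v})}"
        using x v by (auto simp: colourful_def)
    qed
    then show ?thesis using True by simp
  next
    case False
    show ?thesis
    proof (cases "{v \<in> \<sigma>. colourful V S (\<sigma> - {v})} = {}")
      case True
      then show ?thesis using False by (simp del: Collect_empty_eq)
    next
      case ne: False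
      then obtain v where v: "v \<in> \<sigma>" "colourful V S (\<sigma> - {v})" by blast
      obtain j where j: "j \<in> insert i S" "v \<in> V j" using v sub by blast
      \<comment> \<open>A dropped vertex of colour \<open>i\<close> would make
        \<open>\<sigma>\<close> itself colourful for \<open>insert i S\<close>.\<close>
      have "j \<noteq> i"
      proof
        assume [simp]: "j = i"
        have "x \<notin> V i" if "x \<in> \<sigma> - {v}" for x
        proof -
          have "x \<in> \<Union>(V ` S)" using that v(2) unfolding colourful_def by blast
          then obtain k where "k \<in> S" "x \<in> V k" by blast
          then show ?thesis using disj[of x k i] assms(2) by auto
        qed
        then have "\<sigma> \<inter> V i = {v}" using v(1) j by auto
        moreover have "card (\<sigma> \<inter> V k) = 1" if "k \<in> S" for k
        proof -
          have "(\<sigma> - {v}) \<inter> V k = \<sigma> \<inter> V k" using keep[of v i k] j that assms(2) by auto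
          then show ?thesis using that v(2) by (auto simp: colourful_def)
        qed
        ultimately show False using False sub by (auto simp: colourful_def)
      qed
      then have jS: "j \<in> S" using j by simp
      then obtain w where w: "(\<sigma> - {v}) \<inter> V j = {w}"
        using v(2) by (auto simp: colourful_def card_1_singleton_iff)
      have \<sigma>V: "\<sigma> \<subseteq> \<Union>(V ` S)" using v j jS by (auto simp: colourful_def)
      have vw: "\<sigma> \<inter> V j = {v, w}" "v \<noteq> w" using w v j by auto
      have "{v \<in> \<sigma>. colourful V S (\<sigma> - {v})} = {v, w}"
      proof (intro equalityI subsetI)
        fix x assume x: "x \<in> {v \<in> \<sigma>. colourful V S (\<sigma> - {v})}"
        then have "card ((\<sigma> - {x}) \<inter> V j) = 1" using jS by (auto simp: colourful_def)
        moreover have "(\<sigma> - {x}) \<inter> V j = {v, w} - {x}" using vw by blast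
        ultimately have "card ({v, w} - {x}) = 1" by simp
        then show "x \<in> {v, w}" using vw(2) by (cases "x \<in> {v, w}") auto
      next
        fix x assume x: "x \<in> {v, w}"
        have "card ((\<sigma> - {w}) \<inter> V k) = 1" if "k \<in> S" for k
        proof (cases "k = j")
          case True
          have "(\<sigma> - {w}) \<inter> V j = {v}" using vw by blast
          then show ?thesis using True by simp
        next
          case False
          have "w \<in> V j" using w by blast
          then have "(\<sigma> - {w}) \<inter> V k = (\<sigma> - {v}) \<inter> V k"
            using keep[of w j k] keep[of v j k] False j that by auto
          then show ?thesis using v(2) that by (auto simp: colourful_def)
        qed
        then have "colourful V S (\<sigma> - {w})" using \<sigma>V by (auto simp: colourful_def)
        then show "x \<in> {v \<in> \<sigma>. colourful V S (\<sigma> - {v})}" using x v vw by auto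
      qed
      then have "card {v \<in> \<sigma>. colourful V S (\<sigma> - {v})} = 2" using vw(2) by simp
      then show ?thesis using False by simp
    qed
  qed
qed

text \<open>The homological form of Hall's theorem, by a Sperner-type parity argument: the image of
  each face \<open>S\<close> under the carried chain map contains an odd number of colourful
  simplices, in particular at least one for \<open>S = I\<close>.\<close>

theorem colourful_simplex_exists:
  fixes V :: "'i \<Rightarrow> 'a set"
  assumes "finite X" "finite I" "{} \<in> K" "\<And>\<sigma>. \<sigma> \<in> K \<Longrightarrow> \<sigma> \<subseteq> X"
    and disj: "disjoint_family_on V I"
    and conn: "\<And>S. S \<subseteq> I \<Longrightarrow> connected_upto X {\<sigma> \<in> K. \<sigma> \<subseteq> \<Union>(V ` S)} (card S)"
  shows "\<exists>\<sigma>\<in>K. colourful V I \<sigma>"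
proof -
  obtain f where f0: "f {} = (\<lambda>\<sigma>. if \<sigma> = {} then 1 else 0)"
    and ch: "\<And>S. S \<subseteq> I \<Longrightarrow> chain {\<sigma> \<in> K. \<sigma> \<subseteq> \<Union>(V ` S)} (card S) (f S)"
    and bd: "\<And>S. S \<subseteq> I \<Longrightarrow> bd X (f S) = (\<lambda>\<tau>. \<Sum>i\<in>S. f (S - {i}) \<tau>)"
    by (rule carried_chain_map[of X I K V]) (use assms in auto)
  define C where "C S = {\<sigma> \<in> Pow X. colourful V S \<sigma>}" for S
  have finC: "finite (C S)" for S using assms(1) by (simp add: C_def)
  have "S \<subseteq> I \<Longrightarrow> (\<Sum>\<sigma>\<in>C S. f S \<sigma>) = 1" if "finite S" for S
    using that
  proof (induction S rule: finite_induct)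
    case empty
    have "C {} = {{}}" by (auto simp: C_def colourful_def)
    then show ?case by (simp add: f0)
  next
    case (insert i S)
    let ?T = "insert i S"
    have disjT: "disjoint_family_on V ?T" using disj insert.prems disjoint_family_on_mono by blast
    have "1 = (\<Sum>\<tau>\<in>C S. f S \<tau>)" using insert by simp
    also have "\<dots> = (\<Sum>\<tau>\<in>C S. bd X (f ?T) \<tau>)"
    proof (rule sum.cong)
      fix \<tau> assume \<tau>: "\<tau> \<in> C S"
      \<comment> \<open>Every boundary face other than \<open>f S\<close> lacks the vertices of some
        colour \<open>j\<close> in \<open>S\<close>, so no simplex colourful for \<open>S\<close>
        occurs in it.\<close>
      have z: "f (?T - {j}) \<tau> = 0" if j: "j \<in> S" for j
      proof (rule ccontr)
        assume "f (?T - {j}) \<tau> \<noteq> 0"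
        then have sub: "\<tau> \<subseteq> \<Union>(V ` (?T - {j}))"
          using ch[of "?T - {j}"] insert.prems by (auto simp: chain_def)
        have "card (\<tau> \<inter> V j) = 1" using \<tau> j by (simp add: C_def colourful_def)
        then obtain x where x: "x \<in> \<tau>" "x \<in> V j" by (metis IntE card_1_singletonE insertI1)
        then obtain k where "k \<in> ?T - {j}" "x \<in> V k" using sub by blast
        then show False using x j disjT unfolding disjoint_family_on_def by blast
      qed
      have "bd X (f ?T) \<tau> = f (?T - {i}) \<tau> + (\<Sum>j\<in>S. f (?T - {j}) \<tau>)"
        using bd[OF insert.prems] insert.hyps by simp
      also have "?T - {i} = S" using insert.hyps by simp
      finally show "f S \<tau> = bd X (f ?T) \<tau>" using z by simp
    qed simp
    also have "\<dots> = (\<Sum>(\<tau>, v)\<in>Sigma (C S) (\<lambda>\<tau>. X - \<tau>). f ?T (insert v \<tau>))"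
      unfolding bd_def using finC assms(1) by (simp add: sum.Sigma)
    \<comment> \<open>Pairs of a colourful facet and an added vertex are regrouped by the larger
      simplex, where the parity of the number of facets applies.\<close>
    also have "\<dots> = (\<Sum>(\<sigma>, v)\<in>Sigma (Pow X) (\<lambda>\<sigma>. {v \<in> \<sigma>. colourful V S (\<sigma> - {v})}). f ?T \<sigma>)"
      by (rule sum.reindex_bij_witness[where i = "\<lambda>(\<sigma>, v). (\<sigma> - {v}, v)" and j = "\<lambda>(\<tau>, v). (insert v \<tau>, v)"])
         (auto simp: C_def insert_absorb)
    also have "\<dots> = (\<Sum>\<sigma>\<in>Pow X. \<Sum>v\<in>{v \<in> \<sigma>. colourful V S (\<sigma> - {v})}. f ?T \<sigma>)"
      by (rule sum.Sigma[symmetric]) (use assms(1) rev_finite_subset[OF assms(1)] in auto)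
    also have "\<dots> = (\<Sum>\<sigma>\<in>Pow X. if colourful V ?T \<sigma> then f ?T \<sigma> else 0)"
    proof (rule sum.cong)
      fix \<sigma> assume \<sigma>: "\<sigma> \<in> Pow X"
      show "(\<Sum>v\<in>{v \<in> \<sigma>. colourful V S (\<sigma> - {v})}. f ?T \<sigma>) = (if colourful V ?T \<sigma> then f ?T \<sigma> else 0)"
      proof (cases "f ?T \<sigma> = 0")
        case False
        then have "\<sigma> \<subseteq> \<Union>(V ` ?T)" using ch[OF insert.prems] by (auto simp: chain_def)
        moreover have "finite \<sigma>" using \<sigma> assms(1) finite_subset by blast
        ultimately have "of_nat (card {v \<in> \<sigma>. colourful V S (\<sigma> - {v})}) = (if colourful V ?T \<sigma> then 1 else 0 :: bit)"
          using colourful_facets_parity[OF _ insert.hyps(2) disjT, of \<sigma>] by blast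
        then show ?thesis by (simp only: sum_constant) simp
      qed simp
    qed simp
    also have "\<dots> = (\<Sum>\<sigma>\<in>C ?T. f ?T \<sigma>)"
      unfolding C_def using assms(1) by (intro sum.inter_filter[symmetric]) simp
    finally show ?case by simp
  qed
  then have "(\<Sum>\<sigma>\<in>C I. f I \<sigma>) \<noteq> 0" using assms(2) by simp
  then obtain \<sigma> where "\<sigma> \<in> C I" "f I \<sigma> \<noteq> 0" by (meson sum.neutral)
  then show ?thesis using ch[of I] by (auto simp: C_def chain_def)
qed

section \<open>Independence complexes\<close>

definition nbrs :: "'a set set \<Rightarrow> 'a \<Rightarrow> 'a set" where
  "nbrs E v = {w. {v, w} \<in> E}"

definition indep_complex :: "'a set set \<Rightarrow> 'a set \<Rightarrow> 'a set set" where
  "indep_complex E U = {\<sigma>. \<sigma> \<subseteq> U \<and> (\<forall>x\<in>\<sigma>. \<forall>y\<in>\<sigma>. {x, y} \<notin> E)}"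

lemma nbrs_mono: "E \<subseteq> F \<Longrightarrow> nbrs E v \<subseteq> nbrs F v"
  by (auto simp: nbrs_def)

lemma nbrs_commute: "w \<in> nbrs E v \<longleftrightarrow> v \<in> nbrs E w"
  by (simp add: nbrs_def insert_commute)

lemma connected_upto_0: "connected_upto X K 0"
  by (simp add: connected_upto_def)

text \<open>Deleting the edge adds exactly the simplices \<open>{u, v} \<union> \<tau>\<close> with
  \<open>\<tau>\<close> independent and without neighbours of \<open>u\<close> or \<open>v\<close>.
  The two end points are themselves removed from \<open>U\<close>, being neighbours of each
  other.\<close>

lemma indep_complex_explode:
  assumes "finite X" "U \<subseteq> X" "u \<in> U" "v \<in> U" "u \<noteq> v" "{u, v} \<in> E" "\<And>e. e \<in> E \<Longrightarrow> card e = 2"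
    and conn: "connected_upto X (indep_complex (E - {{u, v}}) U) (Suc k)"
      "connected_upto X (indep_complex E (U - nbrs E u - nbrs E v)) k"
  shows "connected_upto X (indep_complex E U) (Suc k)"
proof (rule connected_upto_explode[OF assms(1) _ _ assms(5) _ _ _ _ _ conn])
  have single: "{x} \<notin> E" for x using assms(7)[of "{x}"] by auto
  show "u \<in> X" "v \<in> X" using assms by auto
  show "indep_complex E U = {\<sigma> \<in> indep_complex (E - {{u, v}}) U. \<not> {u, v} \<subseteq> \<sigma>}"
  proof (intro equalityI subsetI)
    fix \<sigma> assume "\<sigma> \<in> indep_complex E U"
    then show "\<sigma> \<in> {\<sigma> \<in> indep_complex (E - {{u, v}}) U. \<not> {u, v} \<subseteq> \<sigma>}"
      using assms(6) by (auto simp: indep_complex_def)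
  next
    fix \<sigma> assume s: "\<sigma> \<in> {\<sigma> \<in> indep_complex (E - {{u, v}}) U. \<not> {u, v} \<subseteq> \<sigma>}"
    have "{x, y} \<notin> E" if "x \<in> \<sigma>" "y \<in> \<sigma>" for x y
    proof -
      have "{x, y} \<subseteq> \<sigma>" using that by simp
      then have "{x, y} \<noteq> {u, v}" using s by force
      then show ?thesis using s that by (auto simp: indep_complex_def)
    qed
    then show "\<sigma> \<in> indep_complex E U" using s by (auto simp: indep_complex_def)
  qed
  show "\<sigma> \<subseteq> X" if "\<sigma> \<in> indep_complex (E - {{u, v}}) U" for \<sigma>
    using that assms(2) by (auto simp: indep_complex_def)
  show "\<tau> \<in> indep_complex (E - {{u, v}}) U" if "\<sigma> \<in> indep_complex (E - {{u, v}}) U" "\<tau> \<subseteq> \<sigma>" for \<sigma> \<tau>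
    using that by (simp add: indep_complex_def subset_iff)
  show "\<tau> \<in> indep_complex E (U - nbrs E u - nbrs E v)"
    if t: "u \<notin> \<tau>" "v \<notin> \<tau>" "insert u (insert v \<tau>) \<in> indep_complex (E - {{u, v}}) U" for \<tau>
  proof -
    have "\<forall>x\<in>insert u (insert v \<tau>). \<forall>y\<in>insert u (insert v \<tau>). {x, y} \<notin> E - {{u, v}}"
      using t(3) unfolding indep_complex_def by (elim CollectE conjE)
    then have *: "{x, y} \<notin> E - {{u, v}}" if "x \<in> insert u (insert v \<tau>)" "y \<in> insert u (insert v \<tau>)" for x y
      using that by blast
    have "{x, y} \<notin> E" if "x \<in> \<tau>" "y \<in> \<tau>" for x y
      using *[of x y] that t(1) by (auto simp: doubleton_eq_iff)
    moreover have "{u, y} \<notin> E" "{v, y} \<notin> E" if "y \<in> \<tau>" for y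
      using *[of u y] *[of v y] that t(1,2) by (auto simp: doubleton_eq_iff)
    ultimately show ?thesis using t by (auto simp: indep_complex_def nbrs_def)
  qed
  show "u \<notin> \<tau> \<and> v \<notin> \<tau> \<and> insert u (insert v \<tau>) \<in> indep_complex (E - {{u, v}}) U"
    if t: "\<tau> \<in> indep_complex E (U - nbrs E u - nbrs E v)" for \<tau>
  proof -
    have "\<tau> \<subseteq> U - nbrs E u - nbrs E v" using t by (simp add: indep_complex_def)
    moreover have "u \<in> nbrs E v" "v \<in> nbrs E u"
      using assms(6) by (simp_all add: nbrs_def insert_commute)
    moreover have "{x, y} \<notin> E - {{u, v}}" if "x \<in> insert u (insert v \<tau>)" "y \<in> insert u (insert v \<tau>)" for x y
    proof -
      have "{x, y} \<notin> E" if "x \<in> \<tau>" "y \<in> \<tau>" for x y using t that by (simp add: indep_complex_def)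
      moreover have "{u, y} \<notin> E" "{v, y} \<notin> E" "{y, u} \<notin> E" "{y, v} \<notin> E" if "y \<in> \<tau>" for y
        using t that by (auto simp: indep_complex_def nbrs_def insert_commute)
      ultimately show ?thesis using that single by (auto simp: doubleton_eq_iff)
    qed
    ultimately show ?thesis using assms(3,4) by (auto simp: indep_complex_def)
  qed
qed

text \<open>Connectivity from the domination of an independent set, by induction on \<open>k\<close>
  and then on the number of edges. A vertex \<open>a\<close> of \<open>A\<close> without neighbours
  in \<open>U\<close> is the apex of a cone. Otherwise an edge \<open>ab\<close> is deleted, which
  only makes domination harder, or exploded: then \<open>A\<close> loses only neighbours of
  \<open>b\<close>, since it is independent, and adding \<open>b\<close> to a dominating set of the
  rest would dominate \<open>A\<close>.\<close>

lemma indep_complex_undominated: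
  assumes "finite X" "finite E" "U \<subseteq> X" "\<And>e. e \<in> E \<Longrightarrow> card e = 2"
    and "A \<subseteq> U" "\<And>x y. x \<in> A \<Longrightarrow> y \<in> A \<Longrightarrow> {x, y} \<notin> E"
    and "\<And>D. D \<subseteq> X \<Longrightarrow> card D < k \<Longrightarrow> \<not> A \<subseteq> (\<Union>v\<in>D. nbrs E v)"
  shows "connected_upto X (indep_complex E U) k"
  using assms(2-)
proof (induction k arbitrary: E U A)
  case 0
  then show ?case by (simp add: connected_upto_0)
next
  case (Suc k)
  show ?case using Suc.prems
  proof (induction "card E" arbitrary: E rule: less_induct)
    case less
    \<comment> \<open>Not even the empty set may dominate \<open>A\<close>.\<close>
    have "A \<noteq> {}" using less.prems(6)[of "{}"] by simp
    then obtain a where a: "a \<in> A" by blast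
    then have aU: "a \<in> U" "a \<in> X" using less.prems by auto
    show ?case
    proof (cases "nbrs E a \<inter> U = {}")
      case True
      then show ?thesis
      proof (intro connected_upto_cone[OF assms(1) aU(2)])
        fix \<sigma> assume \<sigma>: "\<sigma> \<in> indep_complex E U"
        then show "\<sigma> \<subseteq> X" using less.prems by (auto simp: indep_complex_def)
        have "{a, a} \<notin> E" using less.prems(5) a by blast
        moreover have "{a, y} \<notin> E" "{y, a} \<notin> E" if "y \<in> \<sigma>" for y
          using that \<sigma> True by (auto simp: indep_complex_def nbrs_def insert_commute)
        ultimately show "insert a \<sigma> \<in> indep_complex E U"
          using \<sigma> aU by (auto simp: indep_complex_def)
      qed
    next
      case False
      then obtain b where b: "{a, b} \<in> E" "b \<in> U" by (auto simp: nbrs_def)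
      have "a \<noteq> b" using less.prems(3)[OF b(1)] by auto
      show ?thesis
      proof (rule indep_complex_explode[OF assms(1) less.prems(2) aU(1) b(2) \<open>a \<noteq> b\<close> b(1) less.prems(3)])
        let ?E = "E - {{a, b}}"
        show "connected_upto X (indep_complex ?E U) (Suc k)"
        proof (rule less.hyps)
          show "card ?E < card E" using b(1) less.prems(1) by (meson card_Diff1_less)
          show "\<not> A \<subseteq> (\<Union>v\<in>D. nbrs ?E v)" if D: "D \<subseteq> X" "card D < Suc k" for D
            using less.prems(6)[OF D] nbrs_mono[of ?E E] by blast
        qed (use less.prems in auto)
        let ?U = "U - nbrs E a - nbrs E b"
        show "connected_upto X (indep_complex E ?U) k"
        proof (rule Suc.IH)
          show "A - nbrs E b \<subseteq> ?U"
            using less.prems(4,5) a by (auto simp: nbrs_def)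
          show "\<not> A - nbrs E b \<subseteq> (\<Union>v\<in>D. nbrs E v)" if D: "D \<subseteq> X" "card D < k" for D
          proof
            assume "A - nbrs E b \<subseteq> (\<Union>v\<in>D. nbrs E v)"
            then have "A \<subseteq> (\<Union>v\<in>insert b D. nbrs E v)" by blast
            moreover have "card (insert b D) < Suc k"
              using D assms(1) finite_subset[OF D(1)] by (simp add: card_insert_if)
            ultimately show False using less.prems(6)[of "insert b D"] D b(2) less.prems(2) by blast
          qed
        qed (use less.prems in auto)
      qed
    qed
  qed
qed

text \<open>In the exploration of the independence complex the set \<open>D\<close> collects the end points of the
  edges exploded so far. Only edges inside \<open>A\<close> are exploded, and when none is left the
  independent set \<open>A\<close> is still hard to dominate.\<close>

lemma indep_complex_exploration:
  assumes "finite X" "finite E" "W \<subseteq> X" and E2: "\<And>e. e \<in> E \<Longrightarrow> card e = 2"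
    and "Inv 0 {}"
    and step: "\<And>t D. t < s \<Longrightarrow> D \<subseteq> X \<Longrightarrow> Inv t D \<Longrightarrow>
      \<exists>A. A \<subseteq> W - D - (\<Union>v\<in>D. nbrs E v) \<and>
          (\<forall>D'\<subseteq>X. card D' < s - t \<longrightarrow> \<not> A \<subseteq> (\<Union>v\<in>D'. nbrs E v)) \<and>
          (\<forall>u\<in>A. \<forall>v\<in>A. u \<noteq> v \<longrightarrow> Suc t < s \<longrightarrow> Inv (Suc t) (insert u (insert v D)))"
  shows "connected_upto X (indep_complex E W) s"
proof -
  have "connected_upto X (indep_complex H U) k"
    if "k \<le> s" "D \<subseteq> X" "k > 0 \<Longrightarrow> Inv (s - k) D" "H \<subseteq> E" "U \<subseteq> X" "W - D - (\<Union>v\<in>D. nbrs E v) \<subseteq> U"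
    for k H U D
    using that
  proof (induction k arbitrary: H U D)
    case 0
    then show ?case by (simp add: connected_upto_0)
  next
    case (Suc k)
    obtain A where A: "A \<subseteq> W - D - (\<Union>v\<in>D. nbrs E v)"
      and dom: "\<And>D'. D' \<subseteq> X \<Longrightarrow> card D' < Suc k \<Longrightarrow> \<not> A \<subseteq> (\<Union>v\<in>D'. nbrs E v)"
      and Inv: "\<And>u v. u \<in> A \<Longrightarrow> v \<in> A \<Longrightarrow> u \<noteq> v \<Longrightarrow> k > 0 \<Longrightarrow> Inv (s - k) (insert u (insert v D))"
    proof -
      have eq: "s - (s - Suc k) = Suc k" "Suc (s - Suc k) = s - k" using Suc.prems(1) by auto
      have "Inv (s - Suc k) D" using Suc.prems(3) by simp
      from step[OF _ Suc.prems(2) this, unfolded eq] Suc.prems(1) that show thesis by auto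
    qed
    show ?case using Suc.prems(4)
    proof (induction "card H" arbitrary: H rule: less_induct)
      case less
      have finH: "finite H" using less.prems assms(2) finite_subset by blast
      have H2: "\<And>e. e \<in> H \<Longrightarrow> card e = 2" using less.prems E2 by blast
      show ?case
      proof (cases "\<exists>u\<in>A. \<exists>v\<in>A. {u, v} \<in> H")
        case True
        then obtain u v where uv: "u \<in> A" "v \<in> A" "{u, v} \<in> H" by blast
        have "u \<noteq> v" using H2[OF uv(3)] by auto
        have uvU: "u \<in> U" "v \<in> U" using uv A Suc.prems(6) by auto
        show ?thesis
        proof (rule indep_complex_explode[OF assms(1) Suc.prems(5) uvU \<open>u \<noteq> v\<close> uv(3) H2])
          show "connected_upto X (indep_complex (H - {{u, v}}) U) (Suc k)"
          proof (rule less.hyps)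
            show "card (H - {{u, v}}) < card H" using uv(3) finH by (meson card_Diff1_less)
          qed (use less.prems in auto)
          show "connected_upto X (indep_complex H (U - nbrs H u - nbrs H v)) k"
          proof (rule Suc.IH)
            show "W - insert u (insert v D) - (\<Union>w\<in>insert u (insert v D). nbrs E w) \<subseteq> U - nbrs H u - nbrs H v"
              using Suc.prems(6) nbrs_mono[OF less.prems] by blast
            show "insert u (insert v D) \<subseteq> X" using uvU Suc.prems(2,5) by blast
            show "Inv (s - k) (insert u (insert v D))" if "k > 0"
              using Inv uv \<open>u \<noteq> v\<close> that by blast
          qed (use Suc.prems less.prems in auto)
        qed
      next
        \<comment> \<open>No edge of \<open>H\<close> is left inside \<open>A\<close>, so
          \<open>A\<close> is independent in \<open>H\<close>, and a set dominating it in
          \<open>H\<close> would dominate it in \<open>E\<close>.\<close>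
        case False
        show ?thesis
        proof (rule indep_complex_undominated[OF assms(1) finH Suc.prems(5) H2, where A = A])
          show "\<not> A \<subseteq> (\<Union>v\<in>D. nbrs H v)" if "D \<subseteq> X" "card D < Suc k" for D
            using dom[OF that] nbrs_mono[OF less.prems] by blast
        qed (use A Suc.prems(6) False in auto)
      qed
    qed
  qed
  from this[of s "{}" E W] show ?thesis using assms by simp
qed

section \<open>Quasirandom graphs\<close>

text \<open>The exploration guarantees a decay of \<open>W\<close> no worse than
  \<open>(1 - 2 * p) ^ t\<close>, whereas counts of non-neighbours carry the larger
  \<open>(1 - p) ^ (2 * t)\<close>. The quotient is \<open>(1 - y) ^ t\<close>, at least
  \<open>1 - t y\<close> by Bernoulli, and \<open>s y \<le> 1\<close>; so the loss on the right is
  at most \<open>t\<close>, which the left side has subtracted.\<close>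

lemma exploration_ineq:
  fixes p :: real and s t :: nat
  assumes "t < s" "0 \<le> p" "real s * p \<le> 1"
  shows "(real s - real t - 1) * (1 - p) ^ (2 * t) \<le> real s * (1 - 2 * p) ^ t"
proof (cases "s = Suc t \<or> t = 0")
  case True
  then show ?thesis
  proof (cases "t = 0")
    case False
    then have "2 * p \<le> real s * p" using True assms by (intro mult_right_mono) auto
    then have "0 \<le> 1 - 2 * p" using assms by simp
    then show ?thesis using True False by (simp add: zero_le_power)
  qed simp
next
  case False
  \<comment> \<open>Now \<open>t \<ge> 1\<close> and \<open>s \<ge> t + 2\<close>, so
    \<open>s \<ge> 3\<close>.\<close>
  then have "3 * p \<le> real s * p" using assms by (intro mult_right_mono) auto
  then have p: "p \<le> 1/3" using assms by simp
  \<comment> \<open>Chosen so that \<open>1 - 2 * p\<close> equals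
    \<open>(1 - p) ^ 2 * (1 - y)\<close>.\<close>
  define y where "y = p ^ 2 / (1 - p) ^ 2"
  have "(2/3) ^ 2 \<le> (1 - p) ^ 2" using p by (intro power_mono) auto
  then have sq: "p \<le> (1 - p) ^ 2" "(1 - p) ^ 2 > 0" using p by (auto simp: power2_eq_square)
  have "p * p \<le> p * 1" using p assms by (intro mult_left_mono) auto
  then have y: "0 \<le> y" "y \<le> 1" using sq by (auto simp: y_def power2_eq_square)
  have "real s * p ^ 2 = (real s * p) * p" by (simp add: power2_eq_square)
  also have "\<dots> \<le> 1 * p" using assms by (intro mult_right_mono) auto
  finally have "real s * p ^ 2 \<le> (1 - p) ^ 2" using sq by simp
  then have sy: "real s * y \<le> 1" using sq by (simp add: y_def field_simps)
  have "(1 - p) ^ 2 * (1 - y) = 1 - 2 * p"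
    using sq by (simp add: y_def right_diff_distrib) (simp add: power2_eq_square algebra_simps)
  then have eq: "(1 - 2 * p) ^ t = (1 - p) ^ (2 * t) * (1 - y) ^ t"
    by (metis power_mult power_mult_distrib)
  have "1 + real t * (- y) \<le> (1 + (- y)) ^ t" using y by (intro Bernoulli_inequality) auto
  then have "real s * (1 - real t * y) \<le> real s * (1 - y) ^ t" by (intro mult_left_mono) auto
  moreover have "real t * (real s * y) \<le> real t * 1" using sy by (intro mult_left_mono) auto
  ultimately have "real s - real t - 1 \<le> real s * (1 - y) ^ t" by (simp add: algebra_simps)
  then have "(real s - real t - 1) * (1 - p) ^ (2 * t) \<le> real s * (1 - y) ^ t * (1 - p) ^ (2 * t)"
    using p by (intro mult_right_mono) auto
  then show ?thesis unfolding eq by (simp only: mult_ac)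
qed

text \<open>For \<open>p \<le> 1/3\<close> one has \<open>1 - 2 * p \<ge> exp (- (6 * p))\<close>,
  and \<open>t p \<le> 1\<close> gives \<open>exp (-6)\<close>. If \<open>p > 1/3\<close> and
  \<open>t > 0\<close>, then \<open>s = 2\<close> and \<open>t = 1\<close>, and the factor
  \<open>1 + \<epsilon> / 2\<close> in the hypothesis keeps \<open>1 - 2 * p\<close> above
  \<open>\<epsilon> / 3\<close>. The stated constant lies below both bounds.\<close>

lemma exploration_power_lower_bound:
  fixes p \<epsilon> :: real and s t :: nat
  assumes "t < s" "0 \<le> p" "0 < \<epsilon>" "\<epsilon> \<le> 1" "real s * p * (1 + \<epsilon> / 2) \<le> 1"
  shows "exp (-6) * \<epsilon> / 3 \<le> (1 - 2 * p) ^ t"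
proof -
  have e6: "exp (-6) \<le> (1 :: real)" by simp
  have small: "exp (-6) * \<epsilon> / 3 \<le> exp (-6) * 1" "exp (-6) * \<epsilon> / 3 \<le> \<epsilon> / 3"
    using assms e6 by (auto simp: field_simps mult_left_le_one_le mult_left_le)
  have "real s * p * 1 \<le> real s * p * (1 + \<epsilon> / 2)" using assms by (intro mult_left_mono) auto
  then have sp: "real s * p \<le> 1" using assms(5) by linarith
  show ?thesis
  proof (cases "t = 0 \<or> p \<le> 1/3")
    case True
    then show ?thesis
    proof (cases "t = 0")
      case True
      then show ?thesis using small e6 by simp
    next
      case False
      then have p: "p \<le> 1/3" using True by simp
      have "1 \<le> (1 - 2 * p) * (1 + 6 * p)"
        using mult_left_mono[OF p assms(2)] by (simp add: algebra_simps)
      also have "\<dots> \<le> (1 - 2 * p) * exp (6 * p)" using p by (intro mult_left_mono) auto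
      finally have "exp (- (6 * p)) \<le> 1 - 2 * p" by (simp add: exp_minus field_simps)
      then have "exp (- (6 * p)) ^ t \<le> (1 - 2 * p) ^ t" by (intro power_mono) auto
      moreover have "exp (- (6 * p)) ^ t = exp (- (6 * (real t * p)))"
        by (simp add: exp_of_nat_mult[symmetric] mult_ac)
      moreover have "real t * p \<le> real s * p" using assms by (intro mult_right_mono) auto
      then have "exp (-6) \<le> exp (- (6 * (real t * p)))" using sp by simp
      ultimately show ?thesis using small(1) by linarith
    qed
  next
    case False
    have "s < 3"
    proof (rule ccontr)
      assume "\<not> s < 3"
      then have "3 * p \<le> real s * p" using assms by (intro mult_right_mono) auto
      then show False using sp False by simp
    qed
    then have st: "s = 2" "t = 1" using False assms(1) by auto
    then have "2 * p * (1 + \<epsilon> / 2) \<le> 1" using assms by simp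
    moreover have "2/3 * (\<epsilon> / 2) \<le> 2 * p * (\<epsilon> / 2)" using False assms by (intro mult_right_mono) auto
    ultimately have "2 * p + \<epsilon> / 3 \<le> 1" by (simp add: algebra_simps)
    then show ?thesis using st small by simp
  qed
qed


lemma card_nbrs:
  assumes "\<And>e. e \<in> E \<Longrightarrow> card e = 2"
  shows "card (nbrs E v) = degree E v"
proof -
  have "inj_on (\<lambda>w. {v, w}) (nbrs E v)" by (auto simp: inj_on_def doubleton_eq_iff)
  moreover have "(\<lambda>w. {v, w}) ` nbrs E v = {e \<in> E. v \<in> e}"
  proof (intro equalityI subsetI)
    fix e assume e: "e \<in> {e \<in> E. v \<in> e}"
    then obtain x y where "e = {x, y}" using assms[of e] by (auto simp: card_2_iff)
    then obtain w where "e = {v, w}" using e by (auto simp: insert_commute)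
    then show "e \<in> (\<lambda>w. {v, w}) ` nbrs E v" using e by (auto simp: nbrs_def)
  qed (auto simp: nbrs_def)
  ultimately show ?thesis unfolding degree_def by (metis card_image)
qed

text \<open>The last condition is only imposed on sets \<open>F\<close> of size at most \<open>2 / p\<close>: there are so few of them
  that a union bound allows an error that is small compared to \<open>n\<close>.\<close>

locale quasirandom =
  fixes n :: nat and p \<delta> :: real and E :: "nat set set"
  assumes edges: "E \<subseteq> all_edges n"
    and p: "0 < p" "p \<le> 1"
    and \<delta>: "0 < \<delta>" "\<delta> \<le> 1/16" "4 \<le> \<delta> * (n * p)"
    and max_degree: "(1 - \<delta>) * (n * p) \<le> max_degree n E"
    and few_large_degrees: "\<And>U. U \<subseteq> {..<n} \<Longrightarrow>
      card {v \<in> {..<n}. card (nbrs E v \<inter> U) > card U * p + \<delta> * (n * p)} \<le> \<delta> * card U"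
    and nonneighbours: "\<And>F. F \<subseteq> {..<n} \<Longrightarrow> card F * p \<le> 2 \<Longrightarrow>
      \<bar>card {v \<in> {..<n} - F. nbrs E v \<inter> F = {}} - n * (1 - p) ^ card F\<bar> \<le> \<delta> * n"
begin

abbreviation "X \<equiv> {..<n}"
abbreviation "\<Delta> \<equiv> max_degree n E"
abbreviation undominated :: "nat set \<Rightarrow> nat set \<Rightarrow> nat set" where
  "undominated W D \<equiv> W - D - (\<Union>v\<in>D. nbrs E v)"
abbreviation low :: "nat set \<Rightarrow> nat set" where
  "low U \<equiv> {v \<in> U. card (nbrs E v \<inter> U) \<le> card U * p + \<delta> * (n * p)}"

lemma edge_card: "e \<in> E \<Longrightarrow> card e = 2"
  using edges by (auto simp: all_edges_def)

lemma finite_edges: "finite E"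
proof -
  have "E \<subseteq> Pow X" using edges by (auto simp: all_edges_def)
  then show ?thesis by (rule finite_subset) simp
qed

lemma n_pos: "n > 0"
  using \<delta>(3) by (cases n) auto

lemma nbrs_subset: "nbrs E v \<subseteq> X"
  using edges by (auto simp: nbrs_def all_edges_def)

lemma finite_nbrs: "finite (nbrs E v)"
  using nbrs_subset finite_subset by blast

lemma card_nbrs_le: "card (nbrs E v) \<le> \<Delta>"
proof (cases "v < n")
  case True
  then have "degree E v \<le> \<Delta>" unfolding max_degree_def by (intro Max_ge) auto
  then show ?thesis using card_nbrs[of E v] edge_card by simp
next
  case False
  then have "nbrs E v = {}" using edges by (auto simp: nbrs_def all_edges_def)
  then show ?thesis by simp
qed

lemma max_degree_pos: "\<Delta> > 0"
proof -
  have "n * p > 0" using p n_pos by simp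
  then have "(1 - \<delta>) * (n * p) > 0" using \<delta> by simp
  then show ?thesis using max_degree by linarith
qed

lemma card_low:
  assumes "U \<subseteq> X"
  shows "(1 - \<delta>) * card U \<le> card (low U)"
proof -
  let ?B = "{v \<in> X. card (nbrs E v \<inter> U) > card U * p + \<delta> * (n * p)}"
  have "finite U" using assms finite_subset by blast
  then have "card U \<le> card (low U \<union> ?B)"
    using assms by (intro card_mono) (auto simp: not_le)
  also have "\<dots> \<le> card (low U) + card ?B" by (rule card_Un_le)
  finally show ?thesis using few_large_degrees[OF assms] by (simp add: algebra_simps)
qed

text \<open>Each of the two low vertices has at most \<open>p |U| + \<delta> n p\<close> neighbours
  in the current set \<open>U\<close>; the third \<open>\<delta> n p\<close> pays for
  \<open>u\<close> and \<open>v\<close> themselves.\<close>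

lemma card_undominated_insert2:
  assumes "W \<subseteq> X" "u \<in> low (undominated W D)" "v \<in> low (undominated W D)"
  shows "(1 - 2 * p) * card (undominated W D) - 3 * \<delta> * (n * p)
      \<le> card (undominated W (insert u (insert v D)))"
proof -
  let ?U = "undominated W D"
  have fin: "finite W" using assms finite_subset by blast
  have sub: "?U \<subseteq> undominated W (insert u (insert v D)) \<union> {u, v} \<union> (nbrs E u \<inter> ?U) \<union> (nbrs E v \<inter> ?U)"
    by blast
  have "card ?U \<le> card (undominated W (insert u (insert v D)) \<union> {u, v} \<union> (nbrs E u \<inter> ?U) \<union> (nbrs E v \<inter> ?U))"
    by (rule card_mono[OF _ sub]) (simp add: fin finite_nbrs)
  also have "\<dots> \<le> card (undominated W (insert u (insert v D))) + card {u, v} + card (nbrs E u \<inter> ?U) + card (nbrs E v \<inter> ?U)"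
    by (intro order_trans[OF card_Un_le] add_right_mono) simp
  also have "card {u, v} \<le> 2" by (simp add: card_insert_if)
  finally have "card ?U \<le> card (undominated W (insert u (insert v D))) + 2 + card (nbrs E u \<inter> ?U) + card (nbrs E v \<inter> ?U)"
    by simp
  then have "real (card ?U) \<le> card (undominated W (insert u (insert v D))) + 2 + card (nbrs E u \<inter> ?U) + card (nbrs E v \<inter> ?U)"
    by linarith
  moreover have "card (nbrs E u \<inter> ?U) \<le> card ?U * p + \<delta> * (n * p)" using assms(2) by blast
  moreover have "card (nbrs E v \<inter> ?U) \<le> card ?U * p + \<delta> * (n * p)" using assms(3) by blast
  ultimately show ?thesis using \<delta>(3) by (simp add: algebra_simps)
qed

section \<open>Connectivity on small and on large vertex sets\<close>

text \<open>With \<open>|U| \<le> n / 8\<close> and \<open>\<delta> \<le> 1/16\<close> an explosion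
  removes at most \<open>n p / 4 + 3 n p / 16\<close>, which is below
  \<open>(1 - \<delta>) n p \<le> \<Delta>\<close>. Domination by \<open>s - t - 1\<close> vertices
  would then give \<open>(1 - \<delta>) |W| \<le> (s - 1) \<Delta>\<close>, although
  \<open>(1 - \<delta>) (1 + \<epsilon>) \<ge> 1\<close> forces the left side to be at least
  \<open>s \<Delta>\<close>.\<close>

lemma connected_small:
  fixes \<epsilon> :: real and s :: nat
  assumes "W \<subseteq> X" "card W \<le> n / 8" "s * (1 + \<epsilon>) * \<Delta> \<le> card W" "0 < \<epsilon>" "\<epsilon> \<le> 1" "\<delta> \<le> \<epsilon> / 4"
  shows "connected_upto X (indep_complex E W) s"
proof (rule indep_complex_exploration[where Inv = "\<lambda>t D. real (card W) - t * \<Delta> \<le> card (undominated W D)"])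
  fix t D
  assume t: "t < s" and D: "D \<subseteq> X" and Inv: "real (card W) - t * \<Delta> \<le> card (undominated W D)"
  let ?U = "undominated W D"
  have UX: "?U \<subseteq> X" using assms by blast
  have "finite W" using assms finite_subset by blast
  then have cU: "card ?U \<le> card W" by (intro card_mono) auto
  show "\<exists>A\<subseteq>?U. (\<forall>D'\<subseteq>X. card D' < s - t \<longrightarrow> \<not> A \<subseteq> (\<Union>v\<in>D'. nbrs E v)) \<and>
      (\<forall>u\<in>A. \<forall>v\<in>A. u \<noteq> v \<longrightarrow> Suc t < s \<longrightarrow>
        real (card W) - Suc t * \<Delta> \<le> card (undominated W (insert u (insert v D))))"
  proof (intro exI[of _ "low ?U"] conjI allI impI ballI)
    fix D' assume D': "D' \<subseteq> X" "card D' < s - t"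
    show "\<not> low ?U \<subseteq> (\<Union>v\<in>D'. nbrs E v)"
    proof
      assume "low ?U \<subseteq> (\<Union>v\<in>D'. nbrs E v)"
      moreover have finD': "finite D'" using D' finite_subset by blast
      ultimately have "card (low ?U) \<le> card (\<Union>v\<in>D'. nbrs E v)"
        using finite_nbrs by (intro card_mono) auto
      also have "\<dots> \<le> (\<Sum>v\<in>D'. card (nbrs E v))" by (rule card_UN_le[OF finD'])
      also have "\<dots> \<le> card D' * \<Delta>" using sum_bounded_above[of D' "\<lambda>v. card (nbrs E v)" \<Delta>] card_nbrs_le by simp
      finally have "real (card (low ?U)) \<le> real (card D' * \<Delta>)" by (simp only: of_nat_le_iff)
      also have "\<dots> = card D' * real \<Delta>" by simp
      also have "\<dots> \<le> (real s - t - 1) * \<Delta>" using D' t by (intro mult_right_mono) auto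
      finally have up: "card (low ?U) \<le> (real s - t - 1) * \<Delta>" .
      have "\<delta> * card ?U \<le> \<delta> * card W" using cU \<delta>(1) by (intro mult_left_mono) auto
      then have "real (card W) - t * \<Delta> - \<delta> * card W \<le> card ?U - \<delta> * card ?U"
        using Inv by linarith
      also have "\<dots> \<le> card (low ?U)" using card_low[OF UX] by (simp add: algebra_simps)
      finally have "(1 - \<delta>) * card W \<le> (real s - 1) * \<Delta>" using up by (simp add: algebra_simps)
      moreover have "(1 - \<delta>) * (s * (1 + \<epsilon>) * \<Delta>) \<le> (1 - \<delta>) * card W"
        using assms(3) \<delta> by (intro mult_left_mono) auto
      moreover have "1 \<le> (1 - \<delta>) * (1 + \<epsilon>)"
      proof -
        have "\<delta> * \<epsilon> \<le> \<delta> * 1" using assms \<delta> by (intro mult_left_mono) auto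
        then show ?thesis using assms by (simp add: algebra_simps)
      qed
      then have "1 * (s * real \<Delta>) \<le> (1 - \<delta>) * (1 + \<epsilon>) * (s * real \<Delta>)" by (intro mult_right_mono) auto
      ultimately have "s * real \<Delta> \<le> (real s - 1) * \<Delta>" by (simp add: mult_ac)
      then show False using max_degree_pos by (simp add: algebra_simps)
    qed
  next
    fix u v assume "u \<in> low ?U" "v \<in> low ?U"
    then have "(1 - 2 * p) * card ?U - 3 * \<delta> * (n * p) \<le> card (undominated W (insert u (insert v D)))"
      using card_undominated_insert2 assms(1) by blast
    moreover have "p * card ?U \<le> p * (n / 8)"
      using cU assms(2) p by (intro mult_left_mono) auto
    moreover have "\<delta> * (n * p) \<le> 1/16 * (n * p)" using \<delta> p by (intro mult_right_mono) auto
    moreover have "n * p \<ge> 0" using p by simp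
    ultimately show "real (card W) - Suc t * \<Delta> \<le> card (undominated W (insert u (insert v D)))"
      using Inv max_degree by (simp add: algebra_simps)
  qed auto
qed (simp_all add: assms(1) finite_edges edge_card)

text \<open>The dominated low vertices have no neighbour in \<open>D\<close> but one in
  \<open>D'\<close>, so they lie in \<open>N D - N (D \<union> D')\<close>. Both counts are known up
  to \<open>\<delta> n\<close>, and \<open>(1 - p) ^ b \<ge> 1 - b p\<close> bounds their
  difference. The count is made in the whole graph, because \<open>nonneighbours\<close> says
  nothing about subsets such as \<open>W\<close>.\<close>

lemma card_low_dominated:
  assumes "W \<subseteq> X" "D \<subseteq> X" "D' \<subseteq> X" "low (undominated W D) \<subseteq> (\<Union>v\<in>D'. nbrs E v)"
    and b: "card D' \<le> b" "(card D + b) * p \<le> 2"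
  shows "card (low (undominated W D)) \<le> n * (b * p) * (1 - p) ^ card D + 2 * \<delta> * n"
proof -
  define N where "N F = {v \<in> X - F. nbrs E v \<inter> F = {}}" for F
  let ?F = "D \<union> D'"
  have fin: "finite (N F)" for F by (simp add: N_def)
  have fD: "finite D" "finite D'" using assms finite_subset by blast+
  have cF: "card ?F \<le> card D + b" using card_Un_le[of D D'] b by linarith
  have "card D * p \<le> (card D + b) * p" "card ?F * p \<le> (card D + b) * p"
    using cF p by (intro mult_right_mono; simp)+
  then have ND: "card (N D) \<le> n * (1 - p) ^ card D + \<delta> * n"
    and NF: "n * (1 - p) ^ card ?F - \<delta> * n \<le> card (N ?F)"
    using nonneighbours[of D] nonneighbours[of ?F] assms(2,3) b(2) unfolding N_def[symmetric] by (simp_all add: abs_le_iff)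
  have sub: "low (undominated W D) \<subseteq> N D - N ?F"
  proof
    fix v assume v: "v \<in> low (undominated W D)"
    then obtain w where w: "w \<in> D'" "v \<in> nbrs E w" using assms(4) by blast
    then have "w \<in> nbrs E v" using nbrs_commute by fast
    then have "v \<notin> N ?F" using w by (auto simp: N_def)
    moreover have "nbrs E v \<inter> D = {}"
    proof (rule ccontr)
      assume "nbrs E v \<inter> D \<noteq> {}"
      then obtain x where "x \<in> D" "x \<in> nbrs E v" by blast
      then have "v \<in> nbrs E x" using nbrs_commute by fast
      then show False using v \<open>x \<in> D\<close> by auto
    qed
    then have "v \<in> N D" using v assms(1) by (auto simp: N_def)
    ultimately show "v \<in> N D - N ?F" by simp
  qed
  have "N ?F \<subseteq> N D" by (auto simp: N_def)
  then have "real (card (N D - N ?F)) = card (N D) - real (card (N ?F))"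
    using fin by (simp add: card_Diff_subset of_nat_diff card_mono)
  moreover have "card (low (undominated W D)) \<le> card (N D - N ?F)" using sub fin by (intro card_mono) auto
  moreover have "n * ((1 - p) ^ card D * (1 - b * p)) \<le> n * (1 - p) ^ card ?F"
  proof (intro mult_left_mono)
    have "1 + real b * (- p) \<le> (1 + (- p)) ^ b" using p by (intro Bernoulli_inequality) auto
    then have "(1 - p) ^ card D * (1 - b * p) \<le> (1 - p) ^ card D * (1 - p) ^ b"
      using p by (intro mult_left_mono) auto
    also have "\<dots> = (1 - p) ^ (card D + b)" by (simp add: power_add)
    also have "\<dots> \<le> (1 - p) ^ card ?F" using cF p by (intro power_decreasing) auto
    finally show "(1 - p) ^ card D * (1 - b * p) \<le> (1 - p) ^ card ?F" .
  qed simp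
  ultimately show ?thesis using ND NF by (simp add: algebra_simps)
qed

text \<open>If \<open>b = s - t - 1\<close> vertices dominate the low ones, the lower bound of the
  invariant meets the upper bound \<open>s n p (1 - 2 * p) ^ t + 2 \<delta> n\<close>. With
  \<open>3 \<delta> n\<close> from the invariant and \<open>\<delta> n\<close> from passing to low
  vertices, \<open>(|W| - s n p) (1 - 2 * p) ^ t \<le> 6 \<delta> n\<close>. But the first factor is
  at least \<open>\<epsilon> n / 24\<close> and the second at least
  \<open>exp (-6) * \<epsilon> / 3\<close>.\<close>

lemma connected_large:
  fixes \<epsilon> :: real and s :: nat
  assumes "W \<subseteq> X" "card W > n / 8" "s * (1 + \<epsilon>) * \<Delta> \<le> card W" "0 < \<epsilon>" "\<epsilon> \<le> 1"
    and \<delta>_small: "\<delta> \<le> \<epsilon> / 4" "500 * \<delta> \<le> \<epsilon>\<^sup>2 * exp (-6)"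
  shows "connected_upto X (indep_complex E W) s"
proof (rule indep_complex_exploration[where Inv = "\<lambda>t D. (Suc t \<le> s \<longrightarrow> card D = 2 * t \<and>
    card W * (1 - 2 * p) ^ t - 3 * \<delta> * (n * p) * t \<le> card (undominated W D))"])
  have finW: "finite W" using assms finite_subset by blast
  have "(1 + \<epsilon> / 2) * (n * p) \<le> (1 + \<epsilon>) * ((1 - \<delta>) * (n * p))"
  proof -
    have "\<delta> * \<epsilon> \<le> \<delta> * 1" using assms \<delta> by (intro mult_left_mono) auto
    then have "1 + \<epsilon> / 2 \<le> (1 + \<epsilon>) * (1 - \<delta>)" using assms by (simp add: algebra_simps)
    then show ?thesis using p by (simp add: mult_right_mono flip: mult.assoc)
  qed
  also have "\<dots> \<le> (1 + \<epsilon>) * \<Delta>" using max_degree assms by (intro mult_left_mono) auto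
  finally have "s * ((1 + \<epsilon> / 2) * (n * p)) \<le> s * ((1 + \<epsilon>) * \<Delta>)" by (intro mult_left_mono) auto
  then have W: "(s * n * p) * (1 + \<epsilon> / 2) \<le> card W" using assms(3) by (simp add: mult_ac)
  have "card W \<le> n" using assms(1) card_mono[of X W] by simp
  then have "real n * (s * p * (1 + \<epsilon> / 2)) \<le> real n * 1" using W by (simp add: mult_ac)
  then have sp': "s * p * (1 + \<epsilon> / 2) \<le> 1" by (rule mult_left_le_imp_le) (simp add: n_pos)
  moreover have "s * p * 1 \<le> s * p * (1 + \<epsilon> / 2)" using assms p by (intro mult_left_mono) auto
  ultimately have sp: "s * p \<le> 1" by linarith
  have slack: "card W * \<epsilon> / 3 \<le> card W - s * n * p"
  proof -
    have "s * n * p * (1 + \<epsilon> / 2) \<le> card W * (1 - \<epsilon> / 3) * (1 + \<epsilon> / 2)"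
    proof -
      have "\<epsilon> * \<epsilon> \<le> \<epsilon> * 1" using assms by (intro mult_left_mono) auto
      then have "1 \<le> (1 - \<epsilon> / 3) * (1 + \<epsilon> / 2)" by (simp add: algebra_simps)
      then have "real (card W) * 1 \<le> card W * ((1 - \<epsilon> / 3) * (1 + \<epsilon> / 2))" by (intro mult_left_mono) auto
      then show ?thesis using W by (simp add: mult_ac)
    qed
    then have "s * n * p \<le> card W * (1 - \<epsilon> / 3)" by (rule mult_right_le_imp_le) (use assms in auto)
    then show ?thesis by (simp add: algebra_simps)
  qed
  fix t D
  assume t: "t < s" and D: "D \<subseteq> X" and "Suc t \<le> s \<longrightarrow> card D = 2 * t \<and>
    card W * (1 - 2 * p) ^ t - 3 * \<delta> * (n * p) * t \<le> card (undominated W D)"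
  then have Inv: "card D = 2 * t" "card W * (1 - 2 * p) ^ t - 3 * \<delta> * (n * p) * t \<le> card (undominated W D)"
    by auto
  let ?U = "undominated W D"
  have UX: "?U \<subseteq> X" using assms by blast
  have cU: "card ?U \<le> n" using UX card_mono[of X ?U] by simp
  show "\<exists>A\<subseteq>?U. (\<forall>D'\<subseteq>X. card D' < s - t \<longrightarrow> \<not> A \<subseteq> (\<Union>v\<in>D'. nbrs E v)) \<and>
      (\<forall>u\<in>A. \<forall>v\<in>A. u \<noteq> v \<longrightarrow> Suc t < s \<longrightarrow> Suc (Suc t) \<le> s \<longrightarrow>
        card (insert u (insert v D)) = 2 * Suc t \<and>
        card W * (1 - 2 * p) ^ Suc t - 3 * \<delta> * (n * p) * Suc t \<le> card (undominated W (insert u (insert v D))))"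
  proof (intro exI[of _ "low ?U"] conjI allI impI ballI)
    fix D' assume D': "D' \<subseteq> X" "card D' < s - t"
    show "\<not> low ?U \<subseteq> (\<Union>v\<in>D'. nbrs E v)"
    proof
      assume dom: "low ?U \<subseteq> (\<Union>v\<in>D'. nbrs E v)"
      define b where "b = s - t - 1"
      have b: "card D' \<le> b" "real b = real s - t - 1" using D' t by (auto simp: b_def)
      \<comment> \<open>As \<open>2 t + b \<le> 2 s\<close> and \<open>s p \<le> 1\<close>, all sets
        involved are small enough for \<open>nonneighbours\<close>.\<close>
      have "(card D + b) * p \<le> (2 * s) * p" using p t by (intro mult_right_mono) (auto simp: Inv b_def)
      then have "(card D + b) * p \<le> 2" using sp by simp
      then have "card (low ?U) \<le> n * (b * p) * (1 - p) ^ (2 * t) + 2 * \<delta> * n"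
        using card_low_dominated[OF assms(1) D D'(1) dom b(1)] Inv by simp
      moreover have "n * (b * p) * (1 - p) ^ (2 * t) \<le> n * p * (s * (1 - 2 * p) ^ t)"
      proof -
        have "n * p * ((real s - t - 1) * (1 - p) ^ (2 * t)) \<le> n * p * (s * (1 - 2 * p) ^ t)"
          using exploration_ineq[OF t] p sp by (intro mult_left_mono) auto
        then show ?thesis by (simp add: b mult_ac)
      qed
      moreover have "\<delta> * card ?U \<le> \<delta> * n" using cU \<delta>(1) by (intro mult_left_mono) auto
      then have "card ?U - \<delta> * n \<le> card (low ?U)"
        using card_low[OF UX] by (simp add: algebra_simps)
      moreover have "3 * \<delta> * (n * p) * t \<le> 3 * \<delta> * n"
      proof -
        have "t * p \<le> s * p" using t p by (intro mult_right_mono) auto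
        then have "3 * \<delta> * n * (t * p) \<le> 3 * \<delta> * n * 1" using sp \<delta> by (intro mult_left_mono) auto
        then show ?thesis by (simp add: mult_ac)
      qed
      ultimately have "(card W - s * n * p) * (1 - 2 * p) ^ t \<le> 6 * \<delta> * n"
        using Inv(2) by (simp add: algebra_simps)
      moreover have "(n / 8 * \<epsilon> / 3) * (exp (-6) * \<epsilon> / 3) \<le> (card W - s * n * p) * (1 - 2 * p) ^ t"
      proof (rule mult_mono)
        have "n / 8 * \<epsilon> / 3 \<le> card W * \<epsilon> / 3" using assms by (intro divide_right_mono mult_right_mono) auto
        then show n8: "n / 8 * \<epsilon> / 3 \<le> card W - s * n * p" using slack by linarith
        show "exp (-6) * \<epsilon> / 3 \<le> (1 - 2 * p) ^ t"
          using exploration_power_lower_bound[OF t] p assms sp' by auto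
        show "0 \<le> card W - s * n * p" using slack assms by (smt (verit) divide_nonneg_nonneg mult_nonneg_nonneg of_nat_0_le_iff)
      qed (use assms in auto)
      \<comment> \<open>The constant is \<open>6 * 8 * 3 * 3 = 432\<close>, just below the 500 of
        the hypothesis.\<close>
      ultimately have "n * (\<epsilon>\<^sup>2 * exp (-6)) \<le> n * (432 * \<delta>)" by (simp add: power2_eq_square algebra_simps)
      then have "\<epsilon>\<^sup>2 * exp (-6) \<le> 432 * \<delta>" using n_pos by simp
      then show False using \<delta>_small \<delta>(1) by linarith
    qed
  next
    fix u v assume uv: "u \<in> low ?U" "v \<in> low ?U" "u \<noteq> v" "Suc t < s"
    then show "card (insert u (insert v D)) = 2 * Suc t"
      using D finite_subset[OF D] Inv(1) by simp
    \<comment> \<open>A further explosion is only needed for \<open>s \<ge> 2\<close>; then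
      \<open>1 - 2 * p\<close> is nonnegative and the invariant may be multiplied by it.\<close>
    have "2 * p \<le> s * p" using uv(4) p by (intro mult_right_mono) auto
    then have "2 * p \<le> 1" using sp by linarith
    then have p2: "0 \<le> 1 - 2 * p" "1 - 2 * p \<le> 1" using p by auto
    have "(1 - 2 * p) * (card W * (1 - 2 * p) ^ t) - 1 * (3 * \<delta> * (n * p) * t)
        \<le> (1 - 2 * p) * (card W * (1 - 2 * p) ^ t) - (1 - 2 * p) * (3 * \<delta> * (n * p) * t)"
      using p2 \<delta> p by (intro diff_left_mono mult_right_mono) auto
    also have "\<dots> \<le> (1 - 2 * p) * card ?U"
      using mult_left_mono[OF Inv(2) p2(1)] by (simp add: right_diff_distrib)
    finally show "card W * (1 - 2 * p) ^ Suc t - 3 * \<delta> * (n * p) * Suc t \<le> card (undominated W (insert u (insert v D)))"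
      using card_undominated_insert2[OF assms(1) uv(1,2)] by (simp add: algebra_simps)
  qed auto
qed (simp_all add: assms(1) finite_edges edge_card)

theorem transversal_exists:
  fixes \<epsilon> :: real and r :: nat
    and V :: "nat \<Rightarrow> nat set"
  assumes "0 < \<epsilon>" "\<epsilon> \<le> 1" "\<delta> \<le> \<epsilon> / 4" "500 * \<delta> \<le> \<epsilon>\<^sup>2 * exp (-6)"
    and V: "\<And>i. i < r \<Longrightarrow> V i \<subseteq> X" "disjoint_family_on V {..<r}" "\<And>i. i < r \<Longrightarrow> (1 + \<epsilon>) * \<Delta> \<le> card (V i)"
  shows "\<exists>T. independent_transversal n E r V T"
proof -
  have conn: "connected_upto X {\<sigma> \<in> indep_complex E X. \<sigma> \<subseteq> \<Union>(V ` S)} (card S)" if S: "S \<subseteq> {..<r}" for S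
  proof -
    let ?W = "\<Union>(V ` S)"
    have WX: "?W \<subseteq> X" using S V(1) by blast
    have finS: "finite S" using S finite_subset by blast
    have "finite (V i)" if "i \<in> S" for i
      using V(1)[of i] S that finite_subset by blast
    then have "card ?W = (\<Sum>i\<in>S. card (V i))"
      using disjoint_family_on_mono[OF S V(2)] finS by (intro card_UN_disjoint') auto
    moreover have "card S * ((1 + \<epsilon>) * \<Delta>) \<le> (\<Sum>i\<in>S. real (card (V i)))"
      using S V(3) by (intro sum_bounded_below) auto
    ultimately have W: "card S * (1 + \<epsilon>) * \<Delta> \<le> card ?W" by (simp add: mult.assoc)
    have "connected_upto X (indep_complex E ?W) (card S)"
    proof (cases "card ?W \<le> n / 8")
      case True
      then show ?thesis by (rule connected_small[OF WX _ W assms(1-3)])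
    next
      case False
      then show ?thesis by (intro connected_large[OF WX _ W assms(1-4)]) simp
    qed
    also have "indep_complex E ?W = {\<sigma> \<in> indep_complex E X. \<sigma> \<subseteq> ?W}"
      using WX unfolding indep_complex_def by blast
    finally show ?thesis .
  qed
  have "\<exists>T\<in>indep_complex E X. colourful V {..<r} T"
    by (rule colourful_simplex_exists[OF finite_lessThan finite_lessThan _ _ V(2) conn])
       (simp_all add: indep_complex_def)
  then obtain T where "T \<in> indep_complex E X" "colourful V {..<r} T" ..
  then have "independent_transversal n E r V T"
    unfolding independent_transversal_def independent_set_def colourful_def indep_complex_def by simp
  then show ?thesis ..
qed

end

section \<open>Random graphs\<close>

text \<open>Supplies the variance term of the exponential moment bounds. For negative arguments the
  reciprocal is compared with the quadratic Taylor polynomial.\<close>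

lemma exp_le_quadratic:
  fixes x :: real
  assumes "\<bar>x\<bar> \<le> 1"
  shows "exp x \<le> 1 + x + x\<^sup>2"
proof (cases "x \<ge> 0")
  case True
  then show ?thesis using exp_bound[of x] assms by simp
next
  case False
  define y where "y = - x"
  have y: "0 \<le> y" "y \<le> 1" using False assms by (auto simp: y_def)
  have "0 \<le> y^2 / 2 + y^3 / 2 + y^4 / 2" using y by simp
  moreover have "(1 - y + y\<^sup>2) * (1 + y + y\<^sup>2 / 2) = 1 + (y^2 / 2 + y^3 / 2 + y^4 / 2)"
    by (simp add: field_simps power2_eq_square power3_eq_cube power4_eq_xxxx)
  ultimately have "1 \<le> (1 - y + y\<^sup>2) * (1 + y + y\<^sup>2 / 2)" by linarith
  also have "\<dots> \<le> (1 - y + y\<^sup>2) * exp y"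
    using y by (intro mult_left_mono exp_lower_Taylor_quadratic) auto
  finally have "exp (- y) \<le> 1 - y + y\<^sup>2" by (simp add: exp_minus field_simps)
  then show ?thesis by (simp add: y_def)
qed

lemma finite_all_edges: "finite (all_edges n)"
proof -
  have "all_edges n \<subseteq> Pow {..<n}" by (auto simp: all_edges_def)
  then show ?thesis by (rule finite_subset) simp
qed

lemma set_pmf_gnp: "E \<in> set_pmf (gnp n p) \<Longrightarrow> E \<subseteq> all_edges n"
  by (auto simp: gnp_def)

lemma finite_set_pmf_gnp: "finite (set_pmf (gnp n p))"
proof -
  have "set_pmf (gnp n p) \<subseteq> Pow (all_edges n)" using set_pmf_gnp by blast
  then show ?thesis by (rule finite_subset) (simp add: finite_all_edges)
qed

lemma integrable_gnp: "integrable (measure_pmf (gnp n p)) (f :: _ \<Rightarrow> real)"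
  by (rule integrable_measure_pmf_finite[OF finite_set_pmf_gnp])

text \<open>The one place where independence of the edges enters; the exact moments below are all
  obtained from products over the possible edges.\<close>

lemma expectation_gnp_prod:
  fixes g :: "nat set \<Rightarrow> bool \<Rightarrow> real"
  assumes "0 \<le> p" "p \<le> 1" "\<And>e b. 0 \<le> g e b"
  shows "measure_pmf.expectation (gnp n p) (\<lambda>E. \<Prod>e\<in>all_edges n. g e (e \<in> E))
       = (\<Prod>e\<in>all_edges n. p * g e True + (1 - p) * g e False)"
proof -
  have "measure_pmf.expectation (gnp n p) (\<lambda>E. \<Prod>e\<in>all_edges n. g e (e \<in> E))
      = measure_pmf.expectation (Pi_pmf (all_edges n) False (\<lambda>_. bernoulli_pmf p)) (\<lambda>f. \<Prod>e\<in>all_edges n. g e (f e))"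
    unfolding gnp_def by (simp add: integral_map_pmf)
  also have "\<dots> = (\<Prod>e\<in>all_edges n. measure_pmf.expectation (bernoulli_pmf p) (g e))"
    using assms by (intro expectation_prod_Pi_pmf finite_all_edges) (auto intro: integrable_measure_pmf_finite)
  also have "\<dots> = (\<Prod>e\<in>all_edges n. p * g e True + (1 - p) * g e False)"
    using assms by (simp add: integral_bernoulli_pmf mult.commute)
  finally show ?thesis .
qed

lemma prob_gnp_le_expectation:
  fixes h :: "nat set set \<Rightarrow> real"
  assumes "\<And>E. 0 \<le> h E" "\<And>E. E \<subseteq> all_edges n \<Longrightarrow> Q E \<Longrightarrow> 1 \<le> h E"
  shows "measure_pmf.prob (gnp n p) {E. Q E} \<le> measure_pmf.expectation (gnp n p) h"
proof -
  have "measure_pmf.prob (gnp n p) {E. Q E} = measure_pmf.expectation (gnp n p) (indicator {E. Q E})"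
    by simp
  also have "\<dots> \<le> measure_pmf.expectation (gnp n p) h"
  proof (rule integral_mono_AE[OF integrable_gnp integrable_gnp])
    show "AE E in measure_pmf (gnp n p). indicator {E. Q E} E \<le> h E"
      by (rule AE_pmfI) (use assms set_pmf_gnp in \<open>auto simp: indicator_def\<close>)
  qed
  finally show ?thesis .
qed

lemma expectation_gnp_exp_le:
  fixes c :: "nat set \<Rightarrow> real"
  assumes "0 \<le> p" "p \<le> 1"
  shows "measure_pmf.expectation (gnp n p) (\<lambda>E. exp (\<Sum>e\<in>all_edges n. if e \<in> E then c e else 0))
       \<le> exp (p * (\<Sum>e\<in>all_edges n. exp (c e) - 1))"
proof -
  have "measure_pmf.expectation (gnp n p) (\<lambda>E. exp (\<Sum>e\<in>all_edges n. if e \<in> E then c e else 0))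
      = measure_pmf.expectation (gnp n p) (\<lambda>E. \<Prod>e\<in>all_edges n. exp (if e \<in> E then c e else 0))"
    by (simp add: exp_sum finite_all_edges)
  also have "\<dots> = (\<Prod>e\<in>all_edges n. p * exp (c e) + (1 - p))"
    using expectation_gnp_prod[OF assms, of "\<lambda>e b. exp (if b then c e else 0)"] by simp
  also have "\<dots> \<le> (\<Prod>e\<in>all_edges n. exp (p * (exp (c e) - 1)))"
  proof (intro prod_mono conjI)
    fix e
    show "0 \<le> p * exp (c e) + (1 - p)" using assms by simp
    show "p * exp (c e) + (1 - p) \<le> exp (p * (exp (c e) - 1))"
      using exp_ge_add_one_self[of "p * (exp (c e) - 1)"] by (simp add: algebra_simps)
  qed
  also have "\<dots> = exp (p * (\<Sum>e\<in>all_edges n. exp (c e) - 1))"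
    by (simp add: exp_sum finite_all_edges sum_distrib_left)
  finally show ?thesis .
qed

text \<open>The weight of \<open>e\<close> in the sum of the degrees from \<open>K\<close> into
  \<open>U\<close>. The two sets may overlap, and an edge inside their intersection counts
  twice.\<close>

definition pair_multiplicity :: "nat set \<Rightarrow> nat set \<Rightarrow> nat set \<Rightarrow> nat" where
  "pair_multiplicity K U e = card {x \<in> K \<times> U. {fst x, snd x} = e}"

lemma pair_multiplicity_le:
  assumes "card e = 2"
  shows "pair_multiplicity K U e \<le> 2"
proof -
  obtain a b where e: "e = {a, b}" using assms by (auto simp: card_2_iff)
  have "{x \<in> K \<times> U. {fst x, snd x} = e} \<subseteq> {(a, b), (b, a)}"
    by (auto simp: e doubleton_eq_iff)
  then have "pair_multiplicity K U e \<le> card {(a, b), (b, a)}"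
    unfolding pair_multiplicity_def by (intro card_mono) auto
  also have "card {(a, b), (b, a)} \<le> 2" using card_length[of "[(a, b), (b, a)]"] by simp
  finally show ?thesis .
qed

lemma sum_card_nbrs_eq:
  assumes "finite K" "finite U" "E \<subseteq> all_edges n"
  shows "(\<Sum>v\<in>K. card (nbrs E v \<inter> U)) = (\<Sum>e\<in>all_edges n. if e \<in> E then pair_multiplicity K U e else 0)"
proof -
  have "(\<Sum>v\<in>K. card (nbrs E v \<inter> U)) = (\<Sum>v\<in>K. \<Sum>w\<in>U. of_bool ({v, w} \<in> E))"
  proof (rule sum.cong)
    fix v
    have "(\<Sum>w\<in>U. of_bool ({v, w} \<in> E)) = card (U \<inter> {w. {v, w} \<in> E})"
      using assms(2) by simp
    then show "card (nbrs E v \<inter> U) = (\<Sum>w\<in>U. of_bool ({v, w} \<in> E))"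
      by (simp add: nbrs_def Int_commute)
  qed simp
  also have "\<dots> = (\<Sum>x\<in>K \<times> U. of_bool ({fst x, snd x} \<in> E))"
    by (simp add: sum.cartesian_product case_prod_beta)
  also have "\<dots> = (\<Sum>x\<in>K \<times> U. \<Sum>e\<in>all_edges n. if e \<in> E then of_bool ({fst x, snd x} = e) else 0)"
  proof (rule sum.cong)
    fix x assume "x \<in> K \<times> U"
    have "(\<Sum>e\<in>all_edges n. if e \<in> E then of_bool ({fst x, snd x} = e) else 0)
        = (\<Sum>e\<in>all_edges n. if e = {fst x, snd x} then of_bool ({fst x, snd x} \<in> E) else (0::nat))"
      by (intro sum.cong) auto
    also have "\<dots> = of_bool ({fst x, snd x} \<in> E)" using assms(3) by (auto simp: finite_all_edges)
    finally show "of_bool ({fst x, snd x} \<in> E) = (\<Sum>e\<in>all_edges n. if e \<in> E then of_bool ({fst x, snd x} = e) else (0::nat))"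
      by simp
  qed simp
  also have "\<dots> = (\<Sum>e\<in>all_edges n. \<Sum>x\<in>K \<times> U. if e \<in> E then of_bool ({fst x, snd x} = e) else 0)"
    by (rule sum.swap)
  also have "\<dots> = (\<Sum>e\<in>all_edges n. if e \<in> E then pair_multiplicity K U e else 0)"
  proof (rule sum.cong)
    fix e
    have "(\<Sum>x\<in>K \<times> U. of_bool ({fst x, snd x} = e)) = pair_multiplicity K U e"
      using assms(1,2) unfolding pair_multiplicity_def by (simp add: Int_def)
    then show "(\<Sum>x\<in>K \<times> U. if e \<in> E then of_bool ({fst x, snd x} = e) else 0)
        = (if e \<in> E then pair_multiplicity K U e else 0)" by simp
  qed simp
  finally show ?thesis .
qed

lemma sum_pair_multiplicity:
  assumes "finite K" "finite U"
  shows "(\<Sum>e\<in>all_edges n. pair_multiplicity K U e) = card {x \<in> K \<times> U. {fst x, snd x} \<in> all_edges n}"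
proof -
  have "card {x \<in> K \<times> U. {fst x, snd x} \<in> all_edges n}
      = card (\<Union>e\<in>all_edges n. {x \<in> K \<times> U. {fst x, snd x} = e})"
    by (rule arg_cong[where f = card]) auto
  also have "\<dots> = (\<Sum>e\<in>all_edges n. pair_multiplicity K U e)"
    unfolding pair_multiplicity_def using assms finite_all_edges by (intro card_UN_disjoint) auto
  finally show ?thesis by simp
qed

text \<open>Multiplicities are 0, 1 or 2, so \<open>|l| \<le> 1/2\<close> keeps every exponent in
  the range of the quadratic bound for \<open>exp\<close>; multiplicity 2 determines the coefficient
  of the square of \<open>l\<close>. Both signs of \<open>l\<close> occur, for upper and lower
  tails.\<close>

lemma expectation_gnp_exp_sum_card_nbrs:
  fixes p l :: real
  assumes p: "0 \<le> p" "p \<le> 1" and "finite K" "finite U" and l: "\<bar>l\<bar> \<le> 1/2"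
  shows "measure_pmf.expectation (gnp n p) (\<lambda>E. exp (l * (\<Sum>e\<in>all_edges n. if e \<in> E then pair_multiplicity K U e else 0)))
      \<le> exp (p * (l + 2 * l\<^sup>2) * card {x \<in> K \<times> U. {fst x, snd x} \<in> all_edges n})"
proof -
  let ?m = "pair_multiplicity K U"
  have "l * (\<Sum>e\<in>all_edges n. if e \<in> E then ?m e else 0) = (\<Sum>e\<in>all_edges n. if e \<in> E then l * ?m e else 0)" for E
    by (auto simp: sum_distrib_left intro!: sum.cong)
  then have "measure_pmf.expectation (gnp n p) (\<lambda>E. exp (l * (\<Sum>e\<in>all_edges n. if e \<in> E then ?m e else 0)))
      \<le> exp (p * (\<Sum>e\<in>all_edges n. exp (l * ?m e) - 1))"
    using expectation_gnp_exp_le[OF p, of n "\<lambda>e. l * ?m e"] by simp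
  also have "\<dots> \<le> exp (p * (\<Sum>e\<in>all_edges n. (l + 2 * l\<^sup>2) * ?m e))"
  proof -
    have "exp (l * ?m e) - 1 \<le> (l + 2 * l\<^sup>2) * ?m e" if "e \<in> all_edges n" for e
    proof -
      have "?m e \<le> 2" using that pair_multiplicity_le[of e] by (auto simp: all_edges_def)
      then consider "?m e = 0" | "?m e = 1" | "?m e = 2" by linarith
      then show ?thesis
      proof cases
        case 2
        have "exp l - 1 \<le> l + 2 * l\<^sup>2" using exp_le_quadratic[of l] l zero_le_power2[of l] by linarith
        then show ?thesis using 2 by simp
      next
        case 3
        then show ?thesis using exp_le_quadratic[of "l * 2"] l by (simp add: power2_eq_square algebra_simps)
      qed simp
    qed
    then show ?thesis using p by (auto intro!: mult_left_mono sum_mono)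
  qed
  also have "(\<Sum>e\<in>all_edges n. (l + 2 * l\<^sup>2) * ?m e) = (l + 2 * l\<^sup>2) * real (\<Sum>e\<in>all_edges n. ?m e)"
    by (simp add: sum_distrib_left)
  finally show ?thesis using assms(3,4) by (simp add: sum_pair_multiplicity mult.assoc)
qed

text \<open>Chernoff's bound for the number of edges from \<open>K\<close> to \<open>U\<close>. The
  choice \<open>l = d / 4\<close> minimises \<open>2 l^2 - l d\<close>, with value
  \<open>- d^2 / 8\<close>.\<close>

lemma prob_many_edges:
  fixes p d :: real
  assumes p: "0 \<le> p" "p \<le> 1" and KU: "K \<subseteq> {..<n}" "U \<subseteq> {..<n}" and d: "0 < d" "d \<le> 1"
  shows "measure_pmf.prob (gnp n p) {E. (\<Sum>v\<in>K. card (nbrs E v \<inter> U)) \<ge> card K * (card U * p + d * (n * p))}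
      \<le> exp (- (card K * (n * p) * d\<^sup>2 / 8))"
proof -
  define Z where "Z E = real (\<Sum>e\<in>all_edges n. if e \<in> E then pair_multiplicity K U e else 0)" for E
  define a where "a = card K * (card U * p + d * (n * p))"
  define l where "l = d / 4"
  have fin: "finite K" "finite U" using KU finite_subset by blast+
  have "measure_pmf.prob (gnp n p) {E. (\<Sum>v\<in>K. card (nbrs E v \<inter> U)) \<ge> a}
      \<le> measure_pmf.expectation (gnp n p) (\<lambda>E. exp (l * Z E - l * a))"
  proof (rule prob_gnp_le_expectation)
    fix E assume "E \<subseteq> all_edges n" and *: "real (\<Sum>v\<in>K. card (nbrs E v \<inter> U)) \<ge> a"
    then have "Z E \<ge> a" unfolding Z_def using sum_card_nbrs_eq[OF fin] by metis
    then have "l * a \<le> l * Z E" using d by (intro mult_left_mono) (auto simp: l_def)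
    then show "1 \<le> exp (l * Z E - l * a)" by simp
  qed simp
  also have "\<dots> = measure_pmf.expectation (gnp n p) (\<lambda>E. exp (l * Z E)) * exp (- (l * a))"
    by (simp only: exp_diff exp_minus divide_inverse integral_mult_left_zero)
  also have "\<dots> \<le> exp (p * (l + 2 * l\<^sup>2) * card {x \<in> K \<times> U. {fst x, snd x} \<in> all_edges n}) * exp (- (l * a))"
    unfolding Z_def using expectation_gnp_exp_sum_card_nbrs[OF p fin, of l n] d
    by (intro mult_right_mono) (auto simp: l_def)
  also have "\<dots> \<le> exp (p * (l + 2 * l\<^sup>2) * (card K * card U)) * exp (- (l * a))"
  proof -
    have "card {x \<in> K \<times> U. {fst x, snd x} \<in> all_edges n} \<le> card (K \<times> U)"
      using fin by (intro card_mono) auto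
    then have "card {x \<in> K \<times> U. {fst x, snd x} \<in> all_edges n} \<le> card K * card U"
      by (simp add: card_cartesian_product)
    then show ?thesis using p d by (auto intro!: mult_left_mono simp: l_def simp flip: of_nat_mult)
  qed
  also have "\<dots> = exp (p * (l + 2 * l\<^sup>2) * (card K * card U) - l * a)" by (simp add: exp_diff exp_minus divide_inverse)
  also have "\<dots> \<le> exp (- (card K * (n * p) * d\<^sup>2 / 8))"
  proof -
    have "card U \<le> n" using card_mono[OF _ KU(2)] by simp
    then have "2 * l\<^sup>2 * p * card K * card U \<le> 2 * l\<^sup>2 * p * card K * n"
      using p by (intro mult_left_mono) auto
    then show ?thesis by (simp add: a_def l_def power2_eq_square field_simps)
  qed
  finally show ?thesis by (simp add: a_def)
qed

text \<open>One vertex is enough to bound the maximum degree from below. The summand 1 in the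
  exponent makes up for the vertex having \<open>n - 1\<close> instead of \<open>n\<close> possible
  neighbours.\<close>

lemma prob_small_degree:
  fixes p d :: real
  assumes p: "0 \<le> p" "p \<le> 1" and n: "n > 0" and d: "0 < d" "d \<le> 1"
  shows "measure_pmf.prob (gnp n p) {E. degree E 0 \<le> (1 - d) * (n * p)} \<le> exp (1 - n * p * d\<^sup>2 / 8)"
proof -
  let ?K = "{0}" and ?U = "{..<n}"
  define Z where "Z E = real (\<Sum>e\<in>all_edges n. if e \<in> E then pair_multiplicity ?K ?U e else 0)" for E
  define a where "a = (1 - d) * (n * p)"
  define l where "l = d / 4"
  have "measure_pmf.prob (gnp n p) {E. degree E 0 \<le> a}
      \<le> measure_pmf.expectation (gnp n p) (\<lambda>E. exp ((- l) * Z E + l * a))"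
  proof (rule prob_gnp_le_expectation)
    fix E assume E: "E \<subseteq> all_edges n" and *: "degree E 0 \<le> a"
    have "nbrs E 0 \<subseteq> {..<n}" using E by (auto simp: nbrs_def all_edges_def)
    then have "Z E = card (nbrs E 0)"
      unfolding Z_def using sum_card_nbrs_eq[OF _ _ E, of ?K ?U] by (simp add: Int_absorb2)
    also have "\<dots> = degree E 0" using E by (intro arg_cong[where f = real] card_nbrs) (auto simp: all_edges_def)
    finally have "l * Z E \<le> l * a" using * d by (auto simp: l_def)
    then show "1 \<le> exp ((- l) * Z E + l * a)" by simp
  qed simp
  also have "\<dots> = measure_pmf.expectation (gnp n p) (\<lambda>E. exp ((- l) * Z E)) * exp (l * a)"
    by (simp only: exp_add integral_mult_left_zero)
  also have "\<dots> \<le> exp (p * ((- l) + 2 * (- l)\<^sup>2) * card {x \<in> ?K \<times> ?U. {fst x, snd x} \<in> all_edges n}) * exp (l * a)"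
    unfolding Z_def using expectation_gnp_exp_sum_card_nbrs[OF p, of ?K ?U "- l" n] d
    by (intro mult_right_mono) (auto simp: l_def)
  also have "{x \<in> ?K \<times> ?U. {fst x, snd x} \<in> all_edges n} = ?K \<times> {1..<n}"
    using n by (auto simp: all_edges_def card_insert_if)
  also have "card (?K \<times> {1..<n}) = n - 1" by (simp add: card_cartesian_product)
  also have "exp (p * ((- l) + 2 * (- l)\<^sup>2) * real (n - 1)) * exp (l * a)
      = exp (p * ((- l) + 2 * (- l)\<^sup>2) * real (n - 1) + l * a)" by (simp add: exp_add)
  also have "\<dots> \<le> exp (1 - n * p * d\<^sup>2 / 8)"
  proof -
    have "l - 2 * l\<^sup>2 \<le> 1" using d zero_le_power2[of l] unfolding l_def by linarith
    then have "p * (l - 2 * l\<^sup>2) \<le> p * 1" using p by (intro mult_left_mono) auto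
    then have "p * (l - 2 * l\<^sup>2) \<le> 1" using p by linarith
    then show ?thesis using n by (simp add: a_def l_def power2_eq_square of_nat_diff field_simps)
  qed
  finally show ?thesis by (simp add: a_def)
qed


text \<open>Expanding the power as a sum over sets \<open>T\<close> of vertices reduces the claim to the probability
  that there are no edges between \<open>T\<close> and \<open>F\<close>.\<close>

lemma expectation_gnp_power_nonneighbours:
  fixes p \<theta> :: real
  assumes p: "0 \<le> p" "p \<le> 1" and F: "F \<subseteq> {..<n}"
  shows "measure_pmf.expectation (gnp n p) (\<lambda>E. (1 + \<theta>) ^ card {v \<in> {..<n} - F. nbrs E v \<inter> F = {}})
       = (1 + \<theta> * (1 - p) ^ card F) ^ card ({..<n} - F)"
proof -
  let ?R = "{..<n} - F"
  define Y where "Y E v = (of_bool (nbrs E v \<inter> F = {}) :: real)" for E :: "nat set set" and v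
  have finF: "finite F" using F finite_subset by blast
  have exp_Y: "measure_pmf.expectation (gnp n p) (\<lambda>E. \<Prod>v\<in>T. Y E v) = ((1 - p) ^ card F) ^ card T"
    if T: "T \<subseteq> ?R" for T
  proof -
    \<comment> \<open>The pairs between \<open>T\<close> and \<open>F\<close>. As these sets are
      disjoint, different pairs give different edges, and all of them are absent with probability
      \<open>(1 - p) ^ card S\<close>.\<close>
    define S where "S = (\<lambda>(v, u). {v, u}) ` (T \<times> F)"
    have finT: "finite T" using T finite_subset by blast
    have "inj_on (\<lambda>(v, u). {v, u}) (T \<times> F)"
      using T by (auto simp: inj_on_def doubleton_eq_iff)
    then have card_S: "card S = card T * card F"
      unfolding S_def by (simp add: card_image card_cartesian_product)
    have S: "S \<subseteq> all_edges n"
      using T F by (auto simp: S_def all_edges_def card_insert_if)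
    define g where "g e b = (if e \<in> S \<and> b then 0 else 1 :: real)" for e b
    have "(\<Prod>v\<in>T. Y E v) = (\<Prod>e\<in>all_edges n. g e (e \<in> E))" for E
    proof (cases "\<exists>v\<in>T. nbrs E v \<inter> F \<noteq> {}")
      case True
      then obtain v u where vu: "v \<in> T" "u \<in> F" "{v, u} \<in> E" by (auto simp: nbrs_def)
      then have "{v, u} \<in> S" by (auto simp: S_def)
      then have "(\<Prod>e\<in>all_edges n. g e (e \<in> E)) = 0"
        using S vu(3) by (intro prod_zero finite_all_edges bexI[of _ "{v, u}"]) (auto simp: g_def)
      moreover have "(\<Prod>v\<in>T. Y E v) = 0"
        using True finT by (intro prod_zero) (auto simp: Y_def)
      ultimately show ?thesis by simp
    next
      case False
      have "e \<notin> E" if e: "e \<in> S" for e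
      proof -
        obtain v u where "v \<in> T" "u \<in> F" "e = {v, u}" using e by (auto simp: S_def)
        then show ?thesis using False by (auto simp: nbrs_def)
      qed
      then have "(\<Prod>e\<in>all_edges n. g e (e \<in> E)) = 1" by (intro prod.neutral) (auto simp: g_def)
      moreover have "(\<Prod>v\<in>T. Y E v) = 1" using False by (intro prod.neutral) (auto simp: Y_def)
      ultimately show ?thesis by simp
    qed
    then have "measure_pmf.expectation (gnp n p) (\<lambda>E. \<Prod>v\<in>T. Y E v)
        = (\<Prod>e\<in>all_edges n. p * g e True + (1 - p) * g e False)"
      using expectation_gnp_prod[OF p, of g n] by (simp add: g_def)
    also have "\<dots> = (\<Prod>e\<in>all_edges n. if e \<in> S then 1 - p else 1)"
      by (intro prod.cong) (auto simp: g_def)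
    also have "\<dots> = (1 - p) ^ card S"
      using S finite_all_edges[of n] by (simp add: prod.inter_restrict[symmetric] Int_absorb1)
    finally show ?thesis by (simp add: card_S power_mult mult.commute)
  qed
  have "(1 + \<theta>) ^ card {v \<in> ?R. nbrs E v \<inter> F = {}} = (\<Sum>T\<in>Pow ?R. \<theta> ^ card T * (\<Prod>v\<in>T. Y E v))" for E
  proof -
    have "(1 + \<theta>) ^ card {v \<in> ?R. nbrs E v \<inter> F = {}} = (\<Prod>v\<in>{v \<in> ?R. nbrs E v \<inter> F = {}}. 1 + \<theta>)"
      by simp
    also have "\<dots> = (\<Prod>v\<in>?R. if nbrs E v \<inter> F = {} then 1 + \<theta> else 1)"
      by (intro prod.inter_filter) simp
    also have "\<dots> = (\<Prod>v\<in>?R. \<theta> * Y E v + 1)"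
      by (intro prod.cong) (auto simp: Y_def)
    also have "\<dots> = (\<Sum>T\<in>Pow ?R. (\<Prod>v\<in>T. \<theta> * Y E v) * (\<Prod>v\<in>?R - T. 1))"
      by (intro prod_add) simp
    finally show ?thesis by (simp add: prod.distrib)
  qed
  then have "measure_pmf.expectation (gnp n p) (\<lambda>E. (1 + \<theta>) ^ card {v \<in> ?R. nbrs E v \<inter> F = {}})
      = (\<Sum>T\<in>Pow ?R. \<theta> ^ card T * measure_pmf.expectation (gnp n p) (\<lambda>E. \<Prod>v\<in>T. Y E v))"
    by (simp add: integrable_gnp)
  also have "\<dots> = (\<Sum>T\<in>Pow ?R. (\<Prod>v\<in>T. \<theta> * (1 - p) ^ card F) * (\<Prod>v\<in>?R - T. 1))"
    by (intro sum.cong refl) (simp add: exp_Y power_mult_distrib)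
  also have "\<dots> = (\<Prod>v\<in>?R. \<theta> * (1 - p) ^ card F + 1)"
    by (intro prod_add[symmetric]) simp
  finally show ?thesis by (simp add: add.commute)
qed

text \<open>With \<open>\<theta> = exp l - 1\<close> the exact moment is that of a binomial variable
  with success probability \<open>(1 - p) ^ card F\<close>.\<close>

lemma expectation_gnp_exp_nonneighbours:
  fixes p l :: real
  assumes p: "0 \<le> p" "p \<le> 1" and F: "F \<subseteq> {..<n}" and l: "\<bar>l\<bar> \<le> 1"
  shows "measure_pmf.expectation (gnp n p) (\<lambda>E. exp (l * card {v \<in> {..<n} - F. nbrs E v \<inter> F = {}}))
       \<le> exp (card ({..<n} - F) * (1 - p) ^ card F * (l + l\<^sup>2))"
proof -
  define q where "q = (1 - p) ^ card F"
  have q: "0 \<le> q" "q \<le> 1" using p by (auto simp: q_def intro: power_le_one)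
  have "measure_pmf.expectation (gnp n p) (\<lambda>E. exp (l * card {v \<in> {..<n} - F. nbrs E v \<inter> F = {}}))
      = measure_pmf.expectation (gnp n p) (\<lambda>E. (1 + (exp l - 1)) ^ card {v \<in> {..<n} - F. nbrs E v \<inter> F = {}})"
    by (simp add: exp_of_nat_mult[symmetric] mult.commute)
  also have "\<dots> = (1 + (exp l - 1) * q) ^ card ({..<n} - F)"
    unfolding q_def by (rule expectation_gnp_power_nonneighbours[OF p F])
  also have "\<dots> \<le> exp (q * (l + l\<^sup>2)) ^ card ({..<n} - F)"
  proof (rule power_mono)
    have "(exp l - 1) * q \<le> (l + l\<^sup>2) * q" using exp_le_quadratic[OF l] q by (intro mult_right_mono) auto
    then have "1 + (exp l - 1) * q \<le> 1 + q * (l + l\<^sup>2)" by (simp add: mult.commute)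
    also have "\<dots> \<le> exp (q * (l + l\<^sup>2))" by (rule exp_ge_add_one_self)
    finally show "1 + (exp l - 1) * q \<le> exp (q * (l + l\<^sup>2))" .
    have "(- 1) * q \<le> (exp l - 1) * q" using q by (intro mult_right_mono) auto
    then show "0 \<le> 1 + (exp l - 1) * q" using q by simp
  qed
  finally show ?thesis by (simp add: q_def exp_of_nat_mult[symmetric] mult_ac)
qed

text \<open>Chernoff's bound on both sides. The mean is \<open>(n - card F) q\<close> rather than
  \<open>n q\<close>; in the lower tail this costs up to half of the allowed deviation, hence the
  smaller \<open>l = d / 4\<close> there.\<close>

lemma prob_nonneighbours_deviation:
  fixes p d :: real
  assumes p: "0 \<le> p" "p \<le> 1" and F: "F \<subseteq> {..<n}" and d: "0 < d" "d \<le> 1" and f: "card F \<le> d * n / 2"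
  shows "measure_pmf.prob (gnp n p)
      {E. \<bar>card {v \<in> {..<n} - F. nbrs E v \<inter> F = {}} - n * (1 - p) ^ card F\<bar> > d * n} \<le> 2 * exp (- (n * d\<^sup>2 / 16))"
proof -
  define Z where "Z E = real (card {v \<in> {..<n} - F. nbrs E v \<inter> F = {}})" for E :: "nat set set"
  define q where "q = (1 - p) ^ card F"
  define N where "N = card ({..<n} - F)"
  have q: "0 \<le> q" "q \<le> 1" using p by (auto simp: q_def intro: power_le_one)
  have finF: "finite F" using F finite_subset by blast
  have N: "real N = real n - card F"
    using F finF card_mono[OF _ F] by (simp add: N_def card_Diff_subset of_nat_diff)
  have Nq: "N * q \<le> n * q" "N * q * x\<^sup>2 \<le> n * x\<^sup>2" for x :: real
  proof -
    show "N * q \<le> n * q" using N q by (intro mult_right_mono) auto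
    have "N * q \<le> real n * 1" using N q by (intro mult_mono) auto
    then have "N * q * x\<^sup>2 \<le> n * 1 * x\<^sup>2" by (intro mult_right_mono) auto
    then show "N * q * x\<^sup>2 \<le> n * x\<^sup>2" by simp
  qed
  have tail: "measure_pmf.prob (gnp n p) {E. l * Z E \<ge> l * a} \<le> exp (N * q * (l + l\<^sup>2) - l * a)"
    if l: "\<bar>l\<bar> \<le> 1" for l a :: real
  proof -
    have "measure_pmf.prob (gnp n p) {E. l * Z E \<ge> l * a}
        \<le> measure_pmf.expectation (gnp n p) (\<lambda>E. exp (l * Z E - l * a))"
      by (rule prob_gnp_le_expectation) auto
    also have "\<dots> = measure_pmf.expectation (gnp n p) (\<lambda>E. exp (l * Z E)) * exp (- (l * a))"
      by (simp only: exp_diff exp_minus divide_inverse integral_mult_left_zero)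
    also have "\<dots> \<le> exp (N * q * (l + l\<^sup>2)) * exp (- (l * a))"
      using expectation_gnp_exp_nonneighbours[OF p F l] unfolding N_def q_def Z_def
      by (intro mult_right_mono) auto
    finally show ?thesis by (simp add: exp_diff exp_minus divide_inverse)
  qed
  have up: "measure_pmf.prob (gnp n p) {E. Z E \<ge> n * q + d * n} \<le> exp (- (n * d\<^sup>2 / 16))"
  proof -
    define l where "l = d / 2"
    have "{E. Z E \<ge> n * q + d * n} = {E. l * Z E \<ge> l * (n * q + d * n)}" using d by (auto simp: l_def)
    then have "measure_pmf.prob (gnp n p) {E. Z E \<ge> n * q + d * n} \<le> exp (N * q * (l + l\<^sup>2) - l * (n * q + d * n))"
      using tail[of l "n * q + d * n"] d by (auto simp: l_def)
    also have "\<dots> \<le> exp (- (n * d\<^sup>2 / 16))"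
    proof -
      have "l * (N * q) \<le> l * (n * q)" using Nq(1) d by (intro mult_left_mono) (auto simp: l_def)
      then have "N * q * (l + l\<^sup>2) - l * (n * q + d * n) \<le> n * l\<^sup>2 - l * (d * n)"
        using Nq(2)[of l] by (simp add: algebra_simps)
      also have "\<dots> \<le> - (n * d\<^sup>2 / 16)" using d by (simp add: l_def power2_eq_square field_simps)
      finally show ?thesis by simp
    qed
    finally show ?thesis .
  qed
  have low: "measure_pmf.prob (gnp n p) {E. Z E \<le> n * q - d * n} \<le> exp (- (n * d\<^sup>2 / 16))"
  proof -
    define l where "l = d / 4"
    have "{E. Z E \<le> n * q - d * n} = {E. (- l) * Z E \<ge> (- l) * (n * q - d * n)}" using d by (auto simp: l_def)
    then have "measure_pmf.prob (gnp n p) {E. Z E \<le> n * q - d * n} \<le> exp (N * q * ((- l) + (- l)\<^sup>2) - (- l) * (n * q - d * n))"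
      using tail[of "- l" "n * q - d * n"] d by (auto simp: l_def)
    also have "\<dots> \<le> exp (- (n * d\<^sup>2 / 16))"
    proof -
      have "card F * q \<le> d * n / 2 * 1" using f q d by (intro mult_mono) auto
      then have "n * q - N * q \<le> d * n / 2" by (simp add: N algebra_simps)
      then have "l * (n * q - N * q) \<le> l * (d * n / 2)" using d by (intro mult_left_mono) (auto simp: l_def)
      then have "N * q * ((- l) + (- l)\<^sup>2) - (- l) * (n * q - d * n) \<le> n * l\<^sup>2 - l * (d * n / 2)"
        using Nq(2)[of l] by (simp add: algebra_simps)
      also have "\<dots> = - (n * d\<^sup>2 / 16)" by (simp add: l_def power2_eq_square field_simps)
      finally show ?thesis by simp
    qed
    finally show ?thesis .
  qed
  have "measure_pmf.prob (gnp n p) {E. \<bar>Z E - n * q\<bar> > d * n}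
      \<le> measure_pmf.prob (gnp n p) ({E. Z E \<ge> n * q + d * n} \<union> {E. Z E \<le> n * q - d * n})"
    by (intro measure_pmf.finite_measure_mono) auto
  also have "\<dots> \<le> measure_pmf.prob (gnp n p) {E. Z E \<ge> n * q + d * n} + measure_pmf.prob (gnp n p) {E. Z E \<le> n * q - d * n}"
    by (intro measure_Un_le) auto
  finally show ?thesis using up low by (simp add: Z_def q_def)
qed

section \<open>The union bound over vertex sets and the limit\<close>

lemma sum_power_card_Pow:
  fixes y :: real
  assumes "finite A"
  shows "(\<Sum>U\<in>Pow A. y ^ card U) = (1 + y) ^ card A"
proof -
  have "(\<Prod>x\<in>A. y + 1) = (\<Sum>U\<in>Pow A. (\<Prod>x\<in>U. y) * (\<Prod>x\<in>A - U. 1))"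
    by (rule prod_add[OF assms])
  then show ?thesis by (simp add: add.commute)
qed

lemma sum_nonempty_subsets_le:
  assumes "n > 0"
  shows "(\<Sum>U\<in>Pow {..<n} - {{}}. (1 / (real n)\<^sup>2) ^ card U) \<le> exp (1 / n) - 1"
proof -
  define y where "y = 1 / (real n)\<^sup>2"
  have "(\<Sum>U\<in>Pow {..<n} - {{}}. y ^ card U) = (\<Sum>U\<in>Pow {..<n}. y ^ card U) - 1"
    by (subst sum_diff1) auto
  also have "\<dots> = (1 + y) ^ n - 1" by (simp add: sum_power_card_Pow)
  also have "(1 + y) ^ n \<le> exp y ^ n"
    by (intro power_mono exp_ge_add_one_self) (simp add: y_def)
  also have "exp y ^ n = exp (1 / n)"
    using assms by (simp add: exp_of_nat_mult[symmetric] y_def power2_eq_square)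
  finally show ?thesis by (simp add: y_def)
qed

text \<open>Three bad events: \<open>B1\<close>, vertex 0 has small degree; \<open>B2\<close>, some
  \<open>K\<close> with \<open>card K > d * card U\<close> sends too many edges to \<open>U\<close>;
  \<open>B3\<close>, some \<open>F\<close> has a wrong number of non-neighbours. For the last two,
  every \<open>k\<close>-set carries weight \<open>y ^ k\<close> with \<open>y\<close> the inverse
  square of \<open>n\<close>, so the sums over all nonempty sets tend to 0.\<close>

lemma prob_not_quasirandom:
  fixes n :: nat and p d :: real
  assumes n: "n > 0" and p: "0 < p" "p \<le> 1" and d: "0 < d" "d \<le> 1/16" "4 \<le> d * (n * p)"
    and np: "2 * (1 + 1 / d) * ln n \<le> n * p * d\<^sup>2 / 8" "64 * ln n + 16 \<le> n * p * d\<^sup>2"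
  shows "measure_pmf.prob (gnp n p) {E. \<not> quasirandom n p d E}
      \<le> (exp (1 / n) - 1)\<^sup>2 + (exp (1 / n) - 1) + exp 1 / (real n)\<^sup>2"
proof -
  define M where "M = measure_pmf (gnp n p)"
  define y where "y = 1 / (real n)\<^sup>2"
  define P where "P = Pow {..<n} - {{}}"
  define many where "many K U = {E. (\<Sum>v\<in>K. card (nbrs E v \<inter> U)) \<ge> card K * (card U * p + d * (n * p))}" for K U :: "nat set"
  define dev where "dev F = {E. \<bar>card {v \<in> {..<n} - F. nbrs E v \<inter> F = {}} - n * (1 - p) ^ card F\<bar> > d * n}" for F :: "nat set"
  define J where "J = {(K, U) \<in> P \<times> P. card K > d * card U}"
  define J' where "J' = {F \<in> P. card F * p \<le> 2}"
  define B1 where "B1 = {E. degree E 0 \<le> (1 - d) * (n * p)}"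
  define B2 where "B2 = (\<Union>(K, U)\<in>J. many K U)"
  define B3 where "B3 = (\<Union>F\<in>J'. dev F)"
  have finP: "finite P" by (simp add: P_def)
  have ln: "ln (real n) \<ge> 0" using n by (simp add: ln_ge_zero)
  have y: "y > 0" using n by (simp add: y_def)
  have y_exp: "y ^ k = exp (- (2 * ln n * k))" for k
  proof -
    have "exp (2 * ln (real n)) = (real n)\<^sup>2" using n by (simp add: exp_double)
    then have "y = exp (- (2 * ln n))" by (simp add: y_def exp_minus inverse_eq_divide)
    then show ?thesis by (simp add: exp_of_nat_mult[symmetric] mult_ac)
  qed
  have sumP: "(\<Sum>U\<in>P. y ^ card U) \<le> exp (1 / n) - 1"
    unfolding P_def y_def by (rule sum_nonempty_subsets_le[OF n])
  have sumP0: "0 \<le> (\<Sum>U\<in>P. y ^ card U)" using y by (intro sum_nonneg) auto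
  have good: "quasirandom n p d E" if E: "E \<subseteq> all_edges n" and nB: "E \<notin> B1" "E \<notin> B2" "E \<notin> B3" for E
  proof
    show "E \<subseteq> all_edges n" by fact
    show "0 < p" "p \<le> 1" "0 < d" "d \<le> 1/16" "4 \<le> d * (n * p)" by fact+
    have "degree E 0 \<le> max_degree n E" unfolding max_degree_def using n by (intro Max_ge) auto
    then show "(1 - d) * (n * p) \<le> max_degree n E" using nB(1) by (simp add: B1_def)
    show "card {v \<in> {..<n}. card (nbrs E v \<inter> U) > card U * p + d * (n * p)} \<le> d * card U"
      if U: "U \<subseteq> {..<n}" for U
    proof (rule ccontr)
      \<comment> \<open>The vertices of too large degree into \<open>U\<close>, taken together, have
        an excess of edges into \<open>U\<close>.\<close>
      define K where "K = {v \<in> {..<n}. card (nbrs E v \<inter> U) > card U * p + d * (n * p)}"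
      assume "\<not> ?thesis"
      then have K: "card K > d * card U" by (simp add: K_def not_le)
      have "K \<noteq> {}" using K d by (auto simp: mult_less_0_iff)
      moreover from this have "U \<noteq> {}" using d by (auto simp: K_def)
      ultimately have "(K, U) \<in> J" using U K by (auto simp: J_def P_def K_def)
      moreover have "card K * (card U * p + d * (n * p)) \<le> (\<Sum>v\<in>K. real (card (nbrs E v \<inter> U)))"
        by (rule sum_bounded_below) (auto simp: K_def)
      then have "E \<in> many K U" by (simp add: many_def)
      ultimately show False using nB(2) by (auto simp: B2_def)
    qed
    show "\<bar>card {v \<in> {..<n} - F. nbrs E v \<inter> F = {}} - n * (1 - p) ^ card F\<bar> \<le> d * n"
      if F: "F \<subseteq> {..<n}" "card F * p \<le> 2" for F
    proof (cases "F = {}")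
      case True
      then show ?thesis using d by simp
    next
      case False
      then have "F \<in> J'" using F by (auto simp: J'_def P_def)
      then have "E \<notin> dev F" using nB(3) by (auto simp: B3_def)
      then show ?thesis by (simp add: dev_def not_less)
    qed
  qed
  have "measure M {E. \<not> quasirandom n p d E} \<le> measure M (B2 \<union> B3 \<union> B1)"
    unfolding M_def
    by (rule measure_pmf.finite_measure_mono_AE) (auto intro!: AE_pmfI dest: set_pmf_gnp good)
  also have "\<dots> \<le> measure M B2 + measure M B3 + measure M B1"
    unfolding M_def by (intro order_trans[OF measure_Un_le] add_right_mono) auto
  also have "measure M B2 \<le> (exp (1 / n) - 1)\<^sup>2"
  proof -
    have sub: "J \<subseteq> P \<times> P" by (auto simp: J_def)
    then have "finite J" using finP finite_subset by blast
    then have "measure M B2 \<le> (\<Sum>x\<in>J. measure M (case x of (K, U) \<Rightarrow> many K U))"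
      unfolding B2_def M_def by (intro measure_UNION_le) auto
    also have "\<dots> \<le> (\<Sum>(K, U)\<in>J. y ^ card K * y ^ card U)"
    proof (rule sum_mono, clarify)
      fix K U assume KU: "(K, U) \<in> J"
      then have k: "d * card U < card K" and X: "K \<subseteq> {..<n}" "U \<subseteq> {..<n}" by (auto simp: J_def P_def)
      have "measure M (many K U) \<le> exp (- (card K * (n * p) * d\<^sup>2 / 8))"
        unfolding M_def many_def using prob_many_edges[OF _ p(2) X] p d by auto
      also have "\<dots> \<le> exp (- (2 * ln n * (card K + card U)))"
      proof -
        \<comment> \<open>The weight of \<open>U\<close> is charged to \<open>K\<close>, which
          explains the factor \<open>1 + 1 / d\<close>.\<close>
        have "card U \<le> card K / d" using k d by (simp add: field_simps)
        then have "2 * ln n * (card K + card U) \<le> 2 * ln n * (card K + card K / d)"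
          using ln by (intro mult_left_mono) auto
        also have "\<dots> = card K * (2 * (1 + 1 / d) * ln n)" by (simp add: algebra_simps)
        also have "\<dots> \<le> card K * (n * p * d\<^sup>2 / 8)" using np(1) by (intro mult_left_mono) auto
        finally show ?thesis by (simp add: mult_ac)
      qed
      also have "\<dots> = y ^ card K * y ^ card U" by (simp add: y_exp distrib_left flip: exp_add)
      finally show "measure M (many K U) \<le> y ^ card K * y ^ card U" .
    qed
    also have "\<dots> \<le> (\<Sum>(K, U)\<in>P \<times> P. y ^ card K * y ^ card U)"
      using sub finP y by (intro sum_mono2) auto
    also have "\<dots> = (\<Sum>U\<in>P. y ^ card U)\<^sup>2"
      by (simp add: power2_eq_square sum_product sum.cartesian_product)
    also have "\<dots> \<le> (exp (1 / n) - 1)\<^sup>2" using sumP sumP0 by (intro power_mono) auto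
    finally show ?thesis .
  qed
  also have "measure M B3 \<le> exp (1 / n) - 1"
  proof -
    have sub: "J' \<subseteq> P" by (auto simp: J'_def)
    then have "finite J'" using finP finite_subset by blast
    then have "measure M B3 \<le> (\<Sum>F\<in>J'. measure M (dev F))"
      unfolding B3_def M_def by (intro measure_UNION_le) auto
    also have "\<dots> \<le> (\<Sum>F\<in>J'. y ^ card F)"
    proof (rule sum_mono)
      fix F assume "F \<in> J'"
      then have F: "F \<subseteq> {..<n}" "card F * p \<le> 2" by (auto simp: J'_def P_def)
      \<comment> \<open>This is where \<open>4 \<le> d n p\<close> admits all sets of size up to
        \<open>2 / p\<close>.\<close>
      have "card F * p \<le> (d * n / 2) * p" using F(2) d(3) by (simp add: mult_ac)
      then have f: "card F \<le> d * n / 2" by (rule mult_right_le_imp_le) (rule p(1))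
      have "measure M (dev F) \<le> 2 * exp (- (n * d\<^sup>2 / 16))"
        unfolding M_def dev_def using prob_nonneighbours_deviation[OF _ p(2) F(1) d(1) _ f] p d by auto
      also have "\<dots> \<le> exp 1 * exp (- (n * d\<^sup>2 / 16))"
        using exp_ge_add_one_self[of 1] by (intro mult_right_mono) auto
      also have "\<dots> = exp (1 - n * d\<^sup>2 / 16)" by (simp flip: exp_add)
      also have "\<dots> \<le> exp (- (2 * ln n * card F))"
      proof -
        \<comment> \<open>Since \<open>card F * p \<le> 2\<close>, the logarithm of the inverse
          weight times \<open>p\<close> is at most \<open>4 ln n\<close>; adding
          \<open>p \<le> 1\<close> and scaling by 16 gives the hypothesis
          \<open>64 * ln n + 16\<close>.\<close>
        have "2 * ln n * (card F * p) \<le> 2 * ln n * 2" using F(2) ln by (intro mult_left_mono) auto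
        then have "(1 + 2 * ln n * card F) * p \<le> (n * d\<^sup>2 / 16) * p"
          using np(2) p(2) by (simp add: algebra_simps)
        then have "1 + 2 * ln n * card F \<le> n * d\<^sup>2 / 16" by (rule mult_right_le_imp_le) (rule p(1))
        then show ?thesis by simp
      qed
      finally show "measure M (dev F) \<le> y ^ card F" by (simp add: y_exp)
    qed
    also have "\<dots> \<le> (\<Sum>F\<in>P. y ^ card F)" using sub finP y by (intro sum_mono2) auto
    finally show ?thesis using sumP by linarith
  qed
  also have "measure M B1 \<le> exp 1 / (real n)\<^sup>2"
  proof -
    have "measure M B1 \<le> exp (1 - n * p * d\<^sup>2 / 8)"
      unfolding M_def B1_def using prob_small_degree[OF _ p(2) n d(1)] p d by auto
    also have "\<dots> \<le> exp (1 - 2 * ln n)" using np(2) ln by simp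
    also have "\<dots> = exp 1 * y ^ 1" unfolding y_exp by (simp flip: exp_add)
    finally show ?thesis by (simp add: y_def)
  qed
  finally show ?thesis by (simp add: M_def)
qed

text \<open>Quasirandomness with an error depending only on \<open>\<epsilon>\<close> has
  probability at least \<open>1 - b n\<close> for large \<open>n\<close>, and it yields transversals
  for all families at once, so no union bound over families is taken.\<close>

theorem theorem1p2:
  fixes p :: "nat \<Rightarrow> real" and \<epsilon> :: real
  assumes "\<And>n. 0 \<le> p n \<and> p n \<le> 1"
    and "\<forall>\<^sub>F n in sequentially. p n \<ge> ln (real n) ^ 4 / real n"
    and "\<epsilon> > 0"
  shows "almost_surely p (\<lambda>n E. \<forall>(r::nat) (V :: nat \<Rightarrow> nat set).
           (\<forall>i<r. V i \<subseteq> {..<n}) \<longrightarrow>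
           disjoint_family_on V {..<r} \<longrightarrow>
           (\<forall>i<r. real (card (V i)) \<ge> (1 + \<epsilon>) * real (max_degree n E)) \<longrightarrow>
           (\<exists>T. independent_transversal n E r V T))"
proof -
  \<comment> \<open>A smaller \<open>\<epsilon>\<close> weakens the size condition, so
    \<open>\<epsilon>\<close> may be capped at 1 as the deterministic part requires.\<close>
  define e where "e = min \<epsilon> 1"
  \<comment> \<open>Makes \<open>500 * d\<close> equal to the required bound; the other conditions
    on \<open>d\<close> follow from \<open>e \<le> 1\<close>.\<close>
  define d where "d = e\<^sup>2 * exp (-6) / 500"
  have e: "0 < e" "e \<le> 1" "e \<le> \<epsilon>" using assms(3) by (auto simp: e_def)
  have "e\<^sup>2 * exp (-6) \<le> e * 1"
    using e by (intro mult_mono) (auto simp: power2_eq_square mult_left_le)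
  then have d: "0 < d" "d \<le> e / 4" "d \<le> 1/16" "500 * d \<le> e\<^sup>2 * exp (-6)"
    using e by (auto simp: d_def)
  define b where "b n = (exp (1 / real n) - 1)\<^sup>2 + (exp (1 / real n) - 1) + exp 1 / (real n)\<^sup>2" for n
  have b: "b \<longlonglongrightarrow> 0" unfolding b_def by real_asymp
  define P where "P n E \<longleftrightarrow> (\<forall>(r::nat) (V :: nat \<Rightarrow> nat set).
           (\<forall>i<r. V i \<subseteq> {..<n}) \<longrightarrow>
           disjoint_family_on V {..<r} \<longrightarrow>
           (\<forall>i<r. real (card (V i)) \<ge> (1 + \<epsilon>) * real (max_degree n E)) \<longrightarrow>
           (\<exists>T. independent_transversal n E r V T))" for n E
  have quasirandom_P: "P n E" if "quasirandom n q d E" for n q E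
    unfolding P_def
  proof (intro allI impI)
    interpret quasirandom n q d E by fact
    fix r :: nat and V :: "nat \<Rightarrow> nat set"
    assume V: "\<forall>i<r. V i \<subseteq> {..<n}" "disjoint_family_on V {..<r}"
      "\<forall>i<r. real (card (V i)) \<ge> (1 + \<epsilon>) * real (max_degree n E)"
    have "(1 + e) * max_degree n E \<le> (1 + \<epsilon>) * max_degree n E"
      using e by (intro mult_right_mono) auto
    then have "(1 + e) * max_degree n E \<le> card (V i)" if "i < r" for i
      using V(3) that by (meson order_trans)
    then show "\<exists>T. independent_transversal n E r V T"
      using transversal_exists[OF e(1,2) d(2,4)] V by blast
  qed
  \<comment> \<open>All requirements on \<open>n p\<close> are linear in \<open>ln n\<close>, and
    the fourth power outgrows them.\<close>
  have large: "\<forall>\<^sub>F n in sequentially. C * ln (real n) + D \<le> ln (real n) ^ 4 * c" if "c > 0" for C D c :: real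
    using that by real_asymp
  have d2: "d\<^sup>2 > 0" and d8: "d\<^sup>2 / 8 > 0" using d by auto
  have lower: "\<forall>\<^sub>F n in sequentially. 1 - b n \<le> measure_pmf.prob (gnp n (p n)) {E. P n E}"
    using assms(2) large[OF d(1), of 0 4] large[OF d2, of 64 16]
      large[OF d8, of "2 * (1 + 1 / d)" 0] eventually_gt_at_top[of 0]
  proof eventually_elim
    case (elim n)
    have np: "ln (real n) ^ 4 \<le> n * p n" using elim by (simp add: field_simps)
    have scale: "ln (real n) ^ 4 * c \<le> n * p n * c" if "c > 0" for c
      using np that by (intro mult_right_mono) auto
    have "4 \<le> n * p n * d" using elim(2) scale[OF d(1)] by linarith
    then have four: "4 \<le> d * (n * p n)" by (simp add: mult_ac)
    then have "0 < d * (n * p n)" by linarith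
    then have pn: "p n > 0" using d(1) assms(1)[of n] by (simp add: zero_less_mult_iff)
    have "measure_pmf.prob (gnp n (p n)) {E. \<not> quasirandom n (p n) d E} \<le> b n"
      unfolding b_def
    proof (rule prob_not_quasirandom)
      show "2 * (1 + 1 / d) * ln n \<le> n * p n * d\<^sup>2 / 8" using elim(4) scale[OF d8] by simp
      show "64 * ln n + 16 \<le> n * p n * d\<^sup>2" using elim(3) scale[OF d2] by simp
    qed (use elim(5) four pn d assms(1)[of n] in auto)
    moreover have "measure_pmf.prob (gnp n (p n)) {E. \<not> quasirandom n (p n) d E}
        = 1 - measure_pmf.prob (gnp n (p n)) {E. quasirandom n (p n) d E}"
      using measure_pmf.prob_compl[of "{E. quasirandom n (p n) d E}" "gnp n (p n)"]
      by (simp add: Collect_neg_eq Compl_eq_Diff_UNIV)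
    moreover have "measure_pmf.prob (gnp n (p n)) {E. quasirandom n (p n) d E}
        \<le> measure_pmf.prob (gnp n (p n)) {E. P n E}"
      using quasirandom_P by (intro measure_pmf.finite_measure_mono) auto
    ultimately show ?case by linarith
  qed
  have "(\<lambda>n. 1 - b n) \<longlonglongrightarrow> 1"
    using tendsto_diff[OF tendsto_const[of 1] b] by (simp only: diff_zero)
  then show ?thesis unfolding almost_surely_def P_def[symmetric]
    by (rule tendsto_sandwich[OF lower _ _ tendsto_const, rotated]) simp
qed

end
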